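(* Let $(D,\star)$ be a finite abelian group whose order $|D|=q=p^m$ is a prime power, and suppose that $(D,\star)\cong(\mathbb{F}_q,+)$. Then for all integers $n,k$ with $1\le k\le n\le q$ there exists an algebraic code $C\subseteq D^n$ of length $n$, dimension $k$ and minimum distance $d=n-k+1$, attaining the Singleton bound. The code can be efficiently decoded in time $O(n^2)$.
   Context: For a finite group $(D,\star)$ with identity $e$, operations on $D^n$ are componentwise. An algebraic code over $D$ is $C=\operatorname{Im}(\varphi)\subseteq D^n$ for an injective group homomorphism $\varphi\colon M\to D^n$ from a finite group $M$ (the message space). The algebraic Hamming distance is $d^{\star}_H(x,y)=|\{i: x_i\star y_i^{-1}\neq e\}|$, and the minimum distance $d$ of $C$ is the minimum of $d^{\star}_H$ over pairs of distinct codewords. The code has dimension $k$ when $|C|=q^k$; parameters are written $[n,k,d]$, and the Singleton bound is $d\le n-k+1$. Decoding means recovering the codeword from a received word with at most $\lfloor (d-1)/2\rfloor$ erroneous coordinates; time is counted in operations over $\mathbb{F}_q$. *)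

theory Defs
  imports
    "HOL-Algebra.Product_Groups"
    "HOL-Algebra.Ring"
    "HOL-Computational_Algebra.Primes"
    "HOL-Library.Landau_Symbols"
begin

section \<open>Algebraic codes\<close>

abbreviation word_group :: "'a monoid \<Rightarrow> nat \<Rightarrow> (nat \<Rightarrow> 'a) monoid" where
  "word_group D n \<equiv> product_group {..<n} (\<lambda>_. D)"

text \<open>
  The message space \<open>M\<close> is an arbitrary finite group. Since HOL does not quantify over types
  inside a formula, its elements are taken from the type of words over \<open>D\<close>; this is no
  restriction, because \<open>M\<close> is isomorphic to the image of \<open>\<phi>\<close>, which lives in that type.
\<close>

definition algebraic_code :: "'a monoid \<Rightarrow> nat \<Rightarrow> (nat \<Rightarrow> 'a) set \<Rightarrow> bool" where
  "algebraic_code D n C \<longleftrightarrow>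
     (\<exists>(M :: (nat \<Rightarrow> 'a) monoid) \<phi>.
        group M \<and> finite (carrier M) \<and>
        \<phi> \<in> hom M (word_group D n) \<and> inj_on \<phi> (carrier M) \<and>
        C = \<phi> ` carrier M)"

definition hamming_distance :: "'a monoid \<Rightarrow> nat \<Rightarrow> (nat \<Rightarrow> 'a) \<Rightarrow> (nat \<Rightarrow> 'a) \<Rightarrow> nat" where
  "hamming_distance D n x y = card {i. i < n \<and> x i \<otimes>\<^bsub>D\<^esub> inv\<^bsub>D\<^esub> (y i) \<noteq> \<one>\<^bsub>D\<^esub>}"

definition minimum_distance :: "'a monoid \<Rightarrow> nat \<Rightarrow> (nat \<Rightarrow> 'a) set \<Rightarrow> nat" where
  "minimum_distance D n C = Min {hamming_distance D n x y |x y. x \<in> C \<and> y \<in> C \<and> x \<noteq> y}"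

definition has_dimension :: "'a monoid \<Rightarrow> (nat \<Rightarrow> 'a) set \<Rightarrow> nat \<Rightarrow> bool" where
  "has_dimension D C k \<longleftrightarrow> card C = order D ^ k"


section \<open>Machine model\<close>

text \<open>
  Programs for a random access machine over a field. The state consists of index registers
  holding natural numbers and of arrays of field elements; the cell \<open>(a, i)\<close> is the entry of
  array \<open>a\<close> whose position is the current content of index register \<open>i\<close>. Every field
  operation, every test and every operation on index registers takes one time unit.
  The syntax mentions neither the field nor its elements, except for zero and one, so that one
  and the same program can be run over all fields and for all code lengths. Index arithmetic is
  restricted to addition and truncated subtraction, so unit cost cannot be exploited by packing
  a long computation into the multiplication of huge integers.
\<close>

type_synonym cell = "nat \<times> nat"

datatype test =
    Index_Less nat nat
  | Field_Eq cell cell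
  | Neg test

datatype program =
    Index_Const nat nat
  | Index_Add nat nat nat
  | Index_Sub nat nat nat
  | Field_Zero cell
  | Field_One cell
  | Field_Copy cell cell
  | Field_Add cell cell cell
  | Field_Sub cell cell cell
  | Field_Mult cell cell cell
  | Field_Div cell cell cell
  | Skip
  | Seq program program
  | Cond test program program
  | While test program

type_synonym 'b state = "(nat \<Rightarrow> nat) \<times> (nat \<Rightarrow> nat \<Rightarrow> 'b)"

fun get :: "'b state \<Rightarrow> cell \<Rightarrow> 'b" where
  "get (\<iota>, \<mu>) (a, i) = \<mu> a (\<iota> i)"

fun put :: "'b state \<Rightarrow> cell \<Rightarrow> 'b \<Rightarrow> 'b state" where
  "put (\<iota>, \<mu>) (a, i) v = (\<iota>, \<mu>(a := (\<mu> a)(\<iota> i := v)))"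

fun put_index :: "'b state \<Rightarrow> nat \<Rightarrow> nat \<Rightarrow> 'b state" where
  "put_index (\<iota>, \<mu>) i v = (\<iota>(i := v), \<mu>)"

fun holds :: "'b state \<Rightarrow> test \<Rightarrow> bool" where
  "holds s (Index_Less i j) \<longleftrightarrow> fst s i < fst s j"
| "holds s (Field_Eq x y) \<longleftrightarrow> get s x = get s y"
| "holds s (Neg t) \<longleftrightarrow> \<not> holds s t"

text \<open>
  \<open>run F P s t s'\<close>: started in state \<open>s\<close>, the program \<open>P\<close> terminates over \<open>F\<close> in state \<open>s'\<close>
  after exactly \<open>t\<close> steps. Division by zero has no successor state. The target of an
  instruction is its first argument.
\<close>

inductive run :: "'b ring \<Rightarrow> program \<Rightarrow> 'b state \<Rightarrow> nat \<Rightarrow> 'b state \<Rightarrow> bool" for F where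
  "run F (Index_Const i c) s 1 (put_index s i c)"
| "run F (Index_Add i j l) s 1 (put_index s i (fst s j + fst s l))"
| "run F (Index_Sub i j l) s 1 (put_index s i (fst s j - fst s l))"
| "run F (Field_Zero x) s 1 (put s x \<zero>\<^bsub>F\<^esub>)"
| "run F (Field_One x) s 1 (put s x \<one>\<^bsub>F\<^esub>)"
| "run F (Field_Copy x y) s 1 (put s x (get s y))"
| "run F (Field_Add x y z) s 1 (put s x (get s y \<oplus>\<^bsub>F\<^esub> get s z))"
| "run F (Field_Sub x y z) s 1 (put s x (get s y \<ominus>\<^bsub>F\<^esub> get s z))"
| "run F (Field_Mult x y z) s 1 (put s x (get s y \<otimes>\<^bsub>F\<^esub> get s z))"
| "get s z \<noteq> \<zero>\<^bsub>F\<^esub> \<Longrightarrow>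
     run F (Field_Div x y z) s 1 (put s x (get s y \<otimes>\<^bsub>F\<^esub> inv\<^bsub>F\<^esub> (get s z)))"
| "run F Skip s 0 s"
| "run F P s t s' \<Longrightarrow> run F Q s' u s'' \<Longrightarrow> run F (Seq P Q) s (t + u) s''"
| "holds s b \<Longrightarrow> run F P s t s' \<Longrightarrow> run F (Cond b P Q) s (Suc t) s'"
| "\<not> holds s b \<Longrightarrow> run F Q s t s' \<Longrightarrow> run F (Cond b P Q) s (Suc t) s'"
| "\<not> holds s b \<Longrightarrow> run F (While b P) s 1 s"
| "holds s b \<Longrightarrow> run F P s t s' \<Longrightarrow> run F (While b P) s' u s'' \<Longrightarrow>
     run F (While b P) s (Suc (t + u)) s''"

inductive_cases run_elims:
  "run F (Index_Const i c) s t s'"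
  "run F (Index_Add i j l) s t s'"
  "run F (Index_Sub i j l) s t s'"
  "run F (Field_Zero x) s t s'"
  "run F (Field_One x) s t s'"
  "run F (Field_Copy x y) s t s'"
  "run F (Field_Add x y z) s t s'"
  "run F (Field_Sub x y z) s t s'"
  "run F (Field_Mult x y z) s t s'"
  "run F (Field_Div x y z) s t s'"
  "run F Skip s t s'"
  "run F (Seq P Q) s t s'"
  "run F (Cond b P Q) s t s'"

inductive_cases run_WhileE: "run F (While b P) s t s'"

lemma run_deterministic:
  "run F P s t s' \<Longrightarrow> run F P s u s'' \<Longrightarrow> u = t \<and> s'' = s'"
proof (induction arbitrary: u s'' rule: run.induct)
  case (12 P s t s' Q v w)
  from 12(5) show ?case by (rule run_elims) (use 12(3,4) in blast)
next
  case (13 s b P t s' Q)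
  from 13(4) show ?case by (rule run_elims) (use 13(1,3) in blast)+
next
  case (14 s b Q t s' P)
  from 14(4) show ?case by (rule run_elims) (use 14(1,3) in blast)+
next
  case (15 s b P)
  from 15(2) show ?case by (rule run_WhileE) (use 15(1) in simp_all)
next
  case (16 s b P t s' v w)
  from 16(6) show ?case by (rule run_WhileE) (use 16(1,4,5) in blast)+
qed (auto elim: run_elims)


section \<open>Decoding\<close>

text \<open>
  On start, index registers 0 and 1 contain \<open>n\<close> and \<open>k\<close>, array 0 the received word (read in
  \<open>F\<close> through the identification \<open>\<psi>\<close>), and array 1 a description \<open>\<alpha>\<close> of the code, consisting
  of \<open>n\<close> field elements that do not depend on the received word (for instance the evaluation
  points of a Reed-Solomon code). Everything else is zero.
\<close>

definition initial_state ::
  "'b ring \<Rightarrow> nat \<Rightarrow> nat \<Rightarrow> (nat \<Rightarrow> 'b) \<Rightarrow> (nat \<Rightarrow> 'b) \<Rightarrow> 'b state" where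
  "initial_state F n k \<alpha> w =
     ((\<lambda>_. 0)(0 := n, 1 := k),
      (\<lambda>_ _. \<zero>\<^bsub>F\<^esub>)(0 := (\<lambda>i. if i < n then w i else \<zero>\<^bsub>F\<^esub>),
                  1 := (\<lambda>i. if i < n then \<alpha> i else \<zero>\<^bsub>F\<^esub>)))"

text \<open>The decoder leaves the codeword in array 2.\<close>

definition decodes_in_time ::
  "program \<Rightarrow> nat \<Rightarrow> 'a monoid \<Rightarrow> 'b ring \<Rightarrow> ('a \<Rightarrow> 'b) \<Rightarrow> nat \<Rightarrow> nat \<Rightarrow> (nat \<Rightarrow> 'b) \<Rightarrow>
   (nat \<Rightarrow> 'a) set \<Rightarrow> bool" where
  "decodes_in_time P N D F \<psi> n k \<alpha> C \<longleftrightarrow>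
     (\<forall>c\<in>C. \<forall>r\<in>carrier (word_group D n).
        hamming_distance D n r c \<le> (minimum_distance D n C - 1) div 2 \<longrightarrow>
        (\<exists>t \<iota> \<mu>. run F P (initial_state F n k \<alpha> (\<lambda>i. \<psi> (r i))) t (\<iota>, \<mu>) \<and> t \<le> N \<and>
           (\<forall>i<n. \<mu> 2 i = \<psi> (c i))))"

end

theory Submission
  imports Defs "HOL-Algebra.Multiplicative_Group"
begin

text \<open>
  The code is a Reed-Solomon code read through \<open>\<psi>\<close>: a message \<open>m\<close> of length \<open>k\<close> is the coefficient
  vector of a polynomial \<open>f\<close> of degree below \<open>k\<close>, and its codeword consists of the values of \<open>f\<close> at
  \<open>n\<close> distinct points \<open>\<alpha> 0, \<dots>, \<alpha> (n - 1)\<close>. Evaluation is additive, so this is a homomorphism, and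
  since a nonzero polynomial of degree below \<open>k\<close> has fewer than \<open>k\<close> roots (\<open>zero_if_many_roots\<close>),
  two codewords differ in at least \<open>n - k + 1\<close> places. A product of \<open>k - 1\<close> of the linear factors
  \<open>X - \<alpha> i\<close> shows that this number is attained.

  To decode a word \<open>w\<close> with at most \<open>(n - k) div 2\<close> errors, consider the pairs \<open>(A, B)\<close> of
  polynomials with \<open>A (\<alpha> x) + B (\<alpha> x) * w x = 0\<close> for all \<open>x < n\<close>. If such a pair has small degree,
  then \<open>A + B * f\<close> has fewer possible roots than there are correct positions, all of which are
  roots; hence \<open>A = - B * f\<close>, and \<open>w\<close> agrees with the codeword wherever \<open>B\<close> does not vanish
  (\<open>key_state_locates_errors\<close>). A pair of small degree comes from Koetter's interpolation algorithm:
  two pairs, a basis of the solutions of the first \<open>i\<close> equations, are kept; to make them satisfy the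
  next equation, the pair of smaller weighted degree among those violating it is multiplied by
  \<open>X - \<alpha> i\<close>, and what the other pair violates it by is cancelled by a linear combination. A round raises
  at most one of the two degrees, and only by one, so after \<open>n\<close> rounds the smaller pair is small
  enough.

  The positions where \<open>B\<close> does not vanish number at least \<open>k\<close>, so Newton interpolation of \<open>w\<close>
  through these positions yields \<open>f\<close> (\<open>newton_state_recovers\<close>).

  Quadratic time comes from never handling coefficients. Every polynomial is stored as its vector of
  values at the points \<open>\<alpha> x\<close>. A linear combination and a multiplication by \<open>X - \<alpha> i\<close> act on these
  vectors entry by entry, and the residual \<open>A (\<alpha> x) + B (\<alpha> x) * w x\<close> is updated in the same way, so
  that each of the \<open>2 * n\<close> rounds takes at most one pass over the positions. Only the degrees that the
  choice of the pair depends on are tracked, in two index registers.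
\<close>

section \<open>Polynomials given by their values\<close>

context UP_domain
begin

definition value_at :: "(nat \<Rightarrow> 'a) \<Rightarrow> 'a \<Rightarrow> 'a" where
  "value_at p x = eval R R id x p"

lemma value_closed [simp]:
  "p \<in> carrier P \<Longrightarrow> x \<in> carrier R \<Longrightarrow> value_at p x \<in> carrier R"
  by (simp add: value_at_def carrier_evalRR)

lemma value_zero [simp]: "x \<in> carrier R \<Longrightarrow> value_at \<zero>\<^bsub>P\<^esub> x = \<zero>"
  using evalRR_monom[of \<zero> x 0] by (simp add: value_at_def)

lemma value_one [simp]: "x \<in> carrier R \<Longrightarrow> value_at \<one>\<^bsub>P\<^esub> x = \<one>"
  by (simp add: value_at_def evalRR_one)

lemma value_add [simp]:
  "p \<in> carrier P \<Longrightarrow> q \<in> carrier P \<Longrightarrow> x \<in> carrier R \<Longrightarrow>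
    value_at (p \<oplus>\<^bsub>P\<^esub> q) x = value_at p x \<oplus> value_at q x"
  by (simp add: value_at_def evalRR_add)

lemma value_minus [simp]:
  "p \<in> carrier P \<Longrightarrow> q \<in> carrier P \<Longrightarrow> x \<in> carrier R \<Longrightarrow>
    value_at (p \<ominus>\<^bsub>P\<^esub> q) x = value_at p x \<ominus> value_at q x"
  by (simp add: value_at_def evalRR_sub)

lemma value_mult [simp]:
  "p \<in> carrier P \<Longrightarrow> q \<in> carrier P \<Longrightarrow> x \<in> carrier R \<Longrightarrow>
    value_at (p \<otimes>\<^bsub>P\<^esub> q) x = value_at p x \<otimes> value_at q x"
  by (simp add: value_at_def evalRR_mult)

lemma value_monom [simp]:
  "c \<in> carrier R \<Longrightarrow> x \<in> carrier R \<Longrightarrow> value_at (monom P c j) x = c \<otimes> x [^] j"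
  by (simp add: value_at_def evalRR_monom)

lemma value_smult [simp]:
  assumes "c \<in> carrier R" "p \<in> carrier P" "x \<in> carrier R"
  shows "value_at (c \<odot>\<^bsub>P\<^esub> p) x = c \<otimes> value_at p x"
  using assms by (simp flip: monom_mult_is_smult)

lemma zero_if_many_roots:
  assumes "p \<in> carrier P" "\<And>j. m \<le> j \<Longrightarrow> coeff P p j = \<zero>"
    and "finite (carrier R)" "inj_on \<alpha> X" "\<alpha> ` X \<subseteq> carrier R"
    and "\<And>x. x \<in> X \<Longrightarrow> value_at p (\<alpha> x) = \<zero>" "m \<le> card X"
  shows "p = \<zero>\<^bsub>P\<^esub>"
proof (rule ccontr)
  assume nz: "p \<noteq> \<zero>\<^bsub>P\<^esub>"
  with assms(1) have "coeff P p (deg R p) \<noteq> \<zero>"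
    by (rule lcoeff_nonzero2)
  with assms(2) have "deg R p < m"
    by (meson not_le)
  moreover have "card X = card (\<alpha> ` X)"
    using assms(4) by (simp add: card_image)
  moreover have "card (\<alpha> ` X) \<le> card {a \<in> carrier R. value_at p a = \<zero>}"
    using assms by (intro card_mono) auto
  moreover have "card {a \<in> carrier R. value_at p a = \<zero>} \<le> deg R p"
    using roots_bound[OF assms(1) nz assms(3)] by (simp add: value_at_def)
  ultimately show False
    using assms(7) by linarith
qed

text \<open>
The product of \<open>X - c\<close> and \<open>p\<close>.
\<close>

definition times_root :: "'a \<Rightarrow> (nat \<Rightarrow> 'a) \<Rightarrow> nat \<Rightarrow> 'a" where
  "times_root c p = monom P \<one> 1 \<otimes>\<^bsub>P\<^esub> p \<ominus>\<^bsub>P\<^esub> c \<odot>\<^bsub>P\<^esub> p"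

lemma times_root_closed [simp]:
  "c \<in> carrier R \<Longrightarrow> p \<in> carrier P \<Longrightarrow> times_root c p \<in> carrier P"
  by (simp add: times_root_def)

lemma coeff_times_root:
  assumes "c \<in> carrier R" "p \<in> carrier P"
  shows "coeff P (times_root c p) j =
    (if j = 0 then \<zero> else coeff P p (j - 1)) \<ominus> c \<otimes> coeff P p j"
proof (cases j)
  case 0
  then show ?thesis
    using assms by (simp add: times_root_def)
next
  case (Suc i)
  have "coeff P (monom P \<one> 1 \<otimes>\<^bsub>P\<^esub> p) (i + 1) = \<one> \<otimes> coeff P p i"
    using assms by (intro coeff_monom_mult) auto
  with Suc show ?thesis
    using assms by (simp add: times_root_def del: coeff_mult)
qed

lemma value_times_root:
  assumes "c \<in> carrier R" "p \<in> carrier P" "x \<in> carrier R"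
  shows "value_at (times_root c p) x = value_at p x \<otimes> (x \<ominus> c)"
proof -
  have "value_at p x \<in> carrier R"
    using assms by simp
  then show ?thesis
    using assms unfolding times_root_def
    by (simp del: value_closed) algebra
qed

text \<open>
  A polynomial that vanishes at the first \<open>m\<close> points and at no other one is the product of the
  corresponding factors \<open>X - \<alpha> i\<close>. Its value vector is a Reed-Solomon codeword of least weight
  for dimension \<open>m + 1\<close>.
\<close>

lemma root_polynomial_exists:
  assumes "inj_on \<alpha> {..<n}" "\<alpha> ` {..<n} \<subseteq> carrier R" "m \<le> n"
  shows "\<exists>p\<in>carrier P. (\<forall>j>m. coeff P p j = \<zero>) \<and> (\<forall>x<n. value_at p (\<alpha> x) = \<zero> \<longleftrightarrow> x < m)"
  using assms(3)
proof (induction m)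
  case 0
  have "\<one>\<^bsub>P\<^esub> \<in> carrier P" "\<forall>j>0. coeff P \<one>\<^bsub>P\<^esub> j = \<zero>"
    "\<forall>x<n. value_at \<one>\<^bsub>P\<^esub> (\<alpha> x) = \<zero> \<longleftrightarrow> x < 0"
    using assms(2) by (auto simp: image_subset_iff)
  then show ?case by blast
next
  case (Suc m)
  then obtain p where p: "p \<in> carrier P" "\<forall>j>m. coeff P p j = \<zero>"
    "\<forall>x<n. value_at p (\<alpha> x) = \<zero> \<longleftrightarrow> x < m"
    by auto
  have \<alpha>: "\<alpha> x \<in> carrier R" if "x < n" for x
    using assms(2) that by auto
  have \<alpha>m: "\<alpha> m \<in> carrier R"
    using Suc.prems by (intro \<alpha>) simp
  have "value_at (times_root (\<alpha> m) p) (\<alpha> x) = \<zero> \<longleftrightarrow> x < Suc m" if "x < n" for x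
  proof -
    have "\<alpha> x \<ominus> \<alpha> m = \<zero> \<longleftrightarrow> x = m"
      using assms(1) Suc.prems that \<alpha> \<alpha>m by (auto dest: inj_onD)
    then show ?thesis
      using p that \<alpha> \<alpha>m by (auto simp: value_times_root R.integral_iff)
  qed
  moreover have "\<forall>j>Suc m. coeff P (times_root (\<alpha> m) p) j = \<zero>"
    using p \<alpha>m by (auto simp: coeff_times_root a_minus_def)
  ultimately show ?case
    using p(1) \<alpha>m by (intro bexI[of _ "times_root (\<alpha> m) p"]) auto
qed

section \<open>Bivariate interpolation\<close>

text \<open>
  The pair \<open>(A, B)\<close> stands for the bivariate polynomial \<open>A(X) + B(X) Y\<close>, which vanishes at the
  points \<open>(\<alpha> x, w x)\<close> with \<open>x < i\<close>. The vectors \<open>e\<close> and \<open>l\<close> are all that a decoder has to store of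
  it: \<open>e\<close> holds its values at all \<open>n\<close> points, \<open>l\<close> those of its coefficient \<open>B\<close> of \<open>Y\<close>, which becomes
  the error locator.
\<close>

definition interpolates :: "(nat \<Rightarrow> 'a) \<Rightarrow> (nat \<Rightarrow> 'a) \<Rightarrow> nat \<Rightarrow> nat \<Rightarrow> (nat \<Rightarrow> 'a) \<Rightarrow> (nat \<Rightarrow> 'a) \<Rightarrow>
    (nat \<Rightarrow> 'a) \<Rightarrow> (nat \<Rightarrow> 'a) \<Rightarrow> bool" where
  "interpolates \<alpha> w n i A B e l \<longleftrightarrow> A \<in> carrier P \<and> B \<in> carrier P \<and>
    (\<forall>x<n. l x = value_at B (\<alpha> x) \<and>
           e x = value_at A (\<alpha> x) \<oplus> value_at B (\<alpha> x) \<otimes> w x) \<and>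
    (\<forall>x<i. e x = \<zero>)"

text \<open>
  The hypothesis on \<open>c\<close> and \<open>c'\<close> says that the two residuals at the point \<open>i\<close> cancel; it will be met
  by taking each multiplier to be the residual of the other pair.
\<close>

lemma interpolates_combine:
  assumes "interpolates \<alpha> w n i A B e l" "interpolates \<alpha> w n i A' B' e' l'"
    and "\<alpha> ` {..<n} \<subseteq> carrier R" "w ` {..<n} \<subseteq> carrier R" "i < n"
    and "c \<in> carrier R" "c' \<in> carrier R" "c \<otimes> e i = c' \<otimes> e' i"
    and "\<And>x. x < n \<Longrightarrow> f x = c \<otimes> e x \<ominus> c' \<otimes> e' x"
    and "\<And>x. x < n \<Longrightarrow> g x = c \<otimes> l x \<ominus> c' \<otimes> l' x"
  shows "interpolates \<alpha> w n (Suc i) (c \<odot>\<^bsub>P\<^esub> A \<ominus>\<^bsub>P\<^esub> c' \<odot>\<^bsub>P\<^esub> A')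
           (c \<odot>\<^bsub>P\<^esub> B \<ominus>\<^bsub>P\<^esub> c' \<odot>\<^bsub>P\<^esub> B') f g"
proof -
  have polys: "A \<in> carrier P" "B \<in> carrier P" "A' \<in> carrier P" "B' \<in> carrier P"
    using assms(1,2) by (auto simp: interpolates_def)
  have vals: "g x = value_at (c \<odot>\<^bsub>P\<^esub> B \<ominus>\<^bsub>P\<^esub> c' \<odot>\<^bsub>P\<^esub> B') (\<alpha> x)"
    "f x = value_at (c \<odot>\<^bsub>P\<^esub> A \<ominus>\<^bsub>P\<^esub> c' \<odot>\<^bsub>P\<^esub> A') (\<alpha> x) \<oplus>
      value_at (c \<odot>\<^bsub>P\<^esub> B \<ominus>\<^bsub>P\<^esub> c' \<odot>\<^bsub>P\<^esub> B') (\<alpha> x) \<otimes> w x" if x: "x < n" for x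
  proof -
    have c: "\<alpha> x \<in> carrier R" "w x \<in> carrier R" "value_at A (\<alpha> x) \<in> carrier R"
      "value_at B (\<alpha> x) \<in> carrier R" "value_at A' (\<alpha> x) \<in> carrier R"
      "value_at B' (\<alpha> x) \<in> carrier R"
      using assms(3,4) x polys by auto
    have d: "l x = value_at B (\<alpha> x)" "l' x = value_at B' (\<alpha> x)"
      "e x = value_at A (\<alpha> x) \<oplus> value_at B (\<alpha> x) \<otimes> w x"
      "e' x = value_at A' (\<alpha> x) \<oplus> value_at B' (\<alpha> x) \<otimes> w x"
      using assms(1,2) x by (auto simp: interpolates_def)
    show "g x = value_at (c \<odot>\<^bsub>P\<^esub> B \<ominus>\<^bsub>P\<^esub> c' \<odot>\<^bsub>P\<^esub> B') (\<alpha> x)"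
      using c polys assms(6,7) by (simp add: assms(10)[OF x] d)
    show "f x = value_at (c \<odot>\<^bsub>P\<^esub> A \<ominus>\<^bsub>P\<^esub> c' \<odot>\<^bsub>P\<^esub> A') (\<alpha> x) \<oplus>
      value_at (c \<odot>\<^bsub>P\<^esub> B \<ominus>\<^bsub>P\<^esub> c' \<odot>\<^bsub>P\<^esub> B') (\<alpha> x) \<otimes> w x"
      using c polys assms(6,7)
      by (simp add: assms(9)[OF x] d del: value_closed) algebra
  qed
  have "e' i \<in> carrier R"
    using assms(2,3,4,5) polys by (auto simp: interpolates_def image_subset_iff)
  then have "f i = \<zero>"
    using assms(5-9) by simp
  moreover have "f x = \<zero>" if "x < i" for x
  proof -
    have "e x = \<zero>" "e' x = \<zero>"
      using assms(1,2) that by (simp_all only: interpolates_def)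
    then show ?thesis
      using that assms(5-7) by (simp add: assms(9))
  qed
  ultimately show ?thesis
    using vals polys assms(6,7) by (auto simp: interpolates_def less_Suc_eq)
qed

lemma interpolates_times_root:
  assumes "interpolates \<alpha> w n i A B e l"
    and "\<alpha> ` {..<n} \<subseteq> carrier R" "w ` {..<n} \<subseteq> carrier R" "i < n"
    and "\<And>x. x < n \<Longrightarrow> f x = e x \<otimes> (\<alpha> x \<ominus> \<alpha> i)"
    and "\<And>x. x < n \<Longrightarrow> g x = l x \<otimes> (\<alpha> x \<ominus> \<alpha> i)"
  shows "interpolates \<alpha> w n (Suc i) (times_root (\<alpha> i) A) (times_root (\<alpha> i) B) f g"
proof -
  have polys: "A \<in> carrier P" "B \<in> carrier P"
    using assms(1) by (auto simp: interpolates_def)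
  have \<alpha>i: "\<alpha> i \<in> carrier R"
    using assms(2,4) by auto
  have vals: "g x = value_at (times_root (\<alpha> i) B) (\<alpha> x)"
    "f x = value_at (times_root (\<alpha> i) A) (\<alpha> x) \<oplus>
      value_at (times_root (\<alpha> i) B) (\<alpha> x) \<otimes> w x"
    "e x \<in> carrier R" if x: "x < n" for x
  proof -
    have c: "\<alpha> x \<in> carrier R" "w x \<in> carrier R" "value_at A (\<alpha> x) \<in> carrier R"
      "value_at B (\<alpha> x) \<in> carrier R"
      using assms(2,3) x polys by auto
    have d: "l x = value_at B (\<alpha> x)"
      "e x = value_at A (\<alpha> x) \<oplus> value_at B (\<alpha> x) \<otimes> w x"
      using assms(1) x by (auto simp: interpolates_def)
    show "e x \<in> carrier R"
      using c d by simp
    show "g x = value_at (times_root (\<alpha> i) B) (\<alpha> x)"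
      using c polys \<alpha>i by (simp add: assms(6)[OF x] d value_times_root)
    show "f x = value_at (times_root (\<alpha> i) A) (\<alpha> x) \<oplus>
      value_at (times_root (\<alpha> i) B) (\<alpha> x) \<otimes> w x"
      using c polys \<alpha>i
      by (simp add: assms(5)[OF x] d value_times_root del: value_closed) algebra
  qed
  have "f x = \<zero>" if "x < Suc i" for x
  proof (cases "x = i")
    case True
    then show ?thesis using vals(3)[of i] assms(4) \<alpha>i by (simp add: assms(5) R.minus_eq R.r_neg)
  next
    case False
    moreover have "\<alpha> x \<in> carrier R"
      using assms(2,4) that by auto
    moreover have "e x = \<zero>"
      using assms(1) that False by (simp only: interpolates_def less_Suc_eq) blast
    ultimately show ?thesis
      using that assms(4) \<alpha>i by (simp add: assms(5))
  qed
  then show ?thesis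
    using vals polys \<alpha>i by (auto simp: interpolates_def)
qed

text \<open>
  Give \<open>Y\<close> the weight \<open>k - 1\<close>, the largest degree of a message polynomial. The first pair has its
  leading term \<open>X^a\<close> in \<open>A\<close>, of weight \<open>a\<close>; the second one has its leading term \<open>X^(b - k) Y\<close> in \<open>B'\<close>, of
  weight \<open>b - 1\<close>. Of two terms of equal weight the one with \<open>Y\<close> counts as the larger, and this is
  why the bounds for the two pairs differ by one. Using \<open>b\<close> in place of the degree of \<open>B'\<close> makes the
  comparison of the two weights the plain test \<open>a < b\<close>. The bound on \<open>a + b\<close> expresses that one point
  costs at most one degree.
\<close>

definition key_state where
  "key_state \<alpha> w n k i a b e l e' l' \<longleftrightarrow> (\<exists>A B A' B'.
     interpolates \<alpha> w n i A B e l \<and> interpolates \<alpha> w n i A' B' e' l' \<and>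
     coeff P A a \<noteq> \<zero> \<and> (\<forall>j>a. coeff P A j = \<zero>) \<and> (\<forall>j. a < j + k \<longrightarrow> coeff P B j = \<zero>) \<and>
     k \<le> b \<and> coeff P B' (b - k) \<noteq> \<zero> \<and>
     (\<forall>j. b < j + k \<longrightarrow> coeff P B' j = \<zero>) \<and> (\<forall>j\<ge>b. coeff P A' j = \<zero>) \<and>
     a + b \<le> i + k)"

lemma key_state_initial:
  assumes "\<alpha> ` {..<n} \<subseteq> carrier R" "w ` {..<n} \<subseteq> carrier R" "1 \<le> k"
    and "\<And>x. x < n \<Longrightarrow> e x = \<one> \<and> l x = \<zero> \<and> e' x = w x \<and> l' x = \<one>"
  shows "key_state \<alpha> w n k 0 0 k e l e' l'"
proof -
  have "interpolates \<alpha> w n 0 \<one>\<^bsub>P\<^esub> \<zero>\<^bsub>P\<^esub> e l" "interpolates \<alpha> w n 0 \<zero>\<^bsub>P\<^esub> \<one>\<^bsub>P\<^esub> e' l'"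
    using assms by (auto simp: interpolates_def image_subset_iff)
  then show ?thesis
    unfolding key_state_def using assms(3)
    by (intro exI[of _ "\<one>\<^bsub>P\<^esub>"] exI[of _ "\<zero>\<^bsub>P\<^esub>"]) auto
qed

lemma key_state_values_closed:
  assumes "key_state \<alpha> w n k i a b e l e' l'"
    and "\<alpha> ` {..<n} \<subseteq> carrier R" "w ` {..<n} \<subseteq> carrier R" "x < n"
  shows "e x \<in> carrier R" "l x \<in> carrier R" "e' x \<in> carrier R" "l' x \<in> carrier R"
  using assms by (auto simp: key_state_def interpolates_def image_subset_iff)

text \<open>
  The pair with the smaller leading term pays with a factor \<open>X - \<alpha> i\<close>. Adding a multiple of it to the
  other pair cannot destroy the larger leading term there, whose coefficient is only multiplied by
  the nonzero residual \<open>e i\<close>. If the other pair has no residual to cancel, nothing is added; hence the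
  disjunction in \<open>pick\<close>.
\<close>

lemma key_state_raise_first:
  assumes "key_state \<alpha> w n k i a b e l e' l'"
    and \<alpha>: "\<alpha> ` {..<n} \<subseteq> carrier R" and w: "w ` {..<n} \<subseteq> carrier R" and i: "i < n"
    and nz: "e i \<noteq> \<zero>" and pick: "e' i = \<zero> \<or> a < b"
    and new: "\<And>x. x < n \<Longrightarrow> f x = e x \<otimes> (\<alpha> x \<ominus> \<alpha> i)"
     "\<And>x. x < n \<Longrightarrow> g x = l x \<otimes> (\<alpha> x \<ominus> \<alpha> i)"
     "\<And>x. x < n \<Longrightarrow> f' x = e i \<otimes> e' x \<ominus> e' i \<otimes> e x"
     "\<And>x. x < n \<Longrightarrow> g' x = e i \<otimes> l' x \<ominus> e' i \<otimes> l x"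
  shows "key_state \<alpha> w n k (Suc i) (Suc a) b f g f' g'"
proof -
  have ei: "e i \<in> carrier R" "e' i \<in> carrier R" "\<alpha> i \<in> carrier R"
    using key_state_values_closed[OF assms(1) \<alpha> w i] \<alpha> i by auto
  obtain A B A' B' where S: "interpolates \<alpha> w n i A B e l" "interpolates \<alpha> w n i A' B' e' l'"
     "coeff P A a \<noteq> \<zero>" "\<forall>j>a. coeff P A j = \<zero>" "\<forall>j. a < j + k \<longrightarrow> coeff P B j = \<zero>"
     "k \<le> b" "coeff P B' (b - k) \<noteq> \<zero>"
     "\<forall>j. b < j + k \<longrightarrow> coeff P B' j = \<zero>" "\<forall>j\<ge>b. coeff P A' j = \<zero>"
     "a + b \<le> i + k"
    using assms(1) unfolding key_state_def by blast
  have polys: "A \<in> carrier P" "B \<in> carrier P" "A' \<in> carrier P" "B' \<in> carrier P"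
    using S(1,2) by (auto simp: interpolates_def)
  let ?A' = "e i \<odot>\<^bsub>P\<^esub> A' \<ominus>\<^bsub>P\<^esub> e' i \<odot>\<^bsub>P\<^esub> A" and ?B' = "e i \<odot>\<^bsub>P\<^esub> B' \<ominus>\<^bsub>P\<^esub> e' i \<odot>\<^bsub>P\<^esub> B"
  have A0: "e' i \<otimes> coeff P A j = \<zero>" if "b \<le> j" for j
    using pick S(4) that ei polys by auto
  have B0: "e' i \<otimes> coeff P B j = \<zero>" if "b \<le> j + k" for j
    using pick S(5) that ei polys by auto
  have "interpolates \<alpha> w n (Suc i) ?A' ?B' f' g'"
    using S(1,2) \<alpha> w i ei new(3,4) by (intro interpolates_combine) (auto simp: R.m_comm)
  moreover have "interpolates \<alpha> w n (Suc i) (times_root (\<alpha> i) A) (times_root (\<alpha> i) B) f g"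
    using S(1) \<alpha> w i new(1,2) by (rule interpolates_times_root)
  moreover have "coeff P ?B' (b - k) \<noteq> \<zero>"
    using B0[of "b - k"] S(6,7) nz ei polys by (auto simp: R.integral_iff a_minus_def)
  moreover have "\<forall>j. b < j + k \<longrightarrow> coeff P ?B' j = \<zero>"
    using B0 S(8) ei polys by (simp add: a_minus_def)
  moreover have "\<forall>j\<ge>b. coeff P ?A' j = \<zero>"
    using A0 S(9) ei polys by (simp add: a_minus_def)
  moreover have "coeff P (times_root (\<alpha> i) A) (Suc a) \<noteq> \<zero>"
    using S(3,4) ei polys by (simp add: coeff_times_root a_minus_def)
  moreover have "\<forall>j>Suc a. coeff P (times_root (\<alpha> i) A) j = \<zero>"
    using S(4) ei polys by (auto simp: coeff_times_root a_minus_def)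
  moreover have "\<forall>j. Suc a < j + k \<longrightarrow> coeff P (times_root (\<alpha> i) B) j = \<zero>"
    using S(5) ei polys by (auto simp: coeff_times_root a_minus_def)
  ultimately show ?thesis
    unfolding key_state_def using S(6,10) by (intro exI conjI) (assumption | simp)+
qed

text \<open>
  The mirror image of \<open>key_state_raise_first\<close>. The alternatives \<open>a < b\<close> and \<open>b \<le> a\<close> are complementary,
  so one of the two lemmas applies whenever some residual does not vanish.
\<close>

lemma key_state_raise_second:
  assumes "key_state \<alpha> w n k i a b e l e' l'"
    and \<alpha>: "\<alpha> ` {..<n} \<subseteq> carrier R" and w: "w ` {..<n} \<subseteq> carrier R" and i: "i < n"
    and nz: "e' i \<noteq> \<zero>" and pick: "e i = \<zero> \<or> b \<le> a"
    and new: "\<And>x. x < n \<Longrightarrow> f' x = e' x \<otimes> (\<alpha> x \<ominus> \<alpha> i)"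
     "\<And>x. x < n \<Longrightarrow> g' x = l' x \<otimes> (\<alpha> x \<ominus> \<alpha> i)"
     "\<And>x. x < n \<Longrightarrow> f x = e' i \<otimes> e x \<ominus> e i \<otimes> e' x"
     "\<And>x. x < n \<Longrightarrow> g x = e' i \<otimes> l x \<ominus> e i \<otimes> l' x"
  shows "key_state \<alpha> w n k (Suc i) a (Suc b) f g f' g'"
proof -
  have ei: "e i \<in> carrier R" "e' i \<in> carrier R" "\<alpha> i \<in> carrier R"
    using key_state_values_closed[OF assms(1) \<alpha> w i] \<alpha> i by auto
  obtain A B A' B' where S: "interpolates \<alpha> w n i A B e l" "interpolates \<alpha> w n i A' B' e' l'"
     "coeff P A a \<noteq> \<zero>" "\<forall>j>a. coeff P A j = \<zero>" "\<forall>j. a < j + k \<longrightarrow> coeff P B j = \<zero>"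
     "k \<le> b" "coeff P B' (b - k) \<noteq> \<zero>"
     "\<forall>j. b < j + k \<longrightarrow> coeff P B' j = \<zero>" "\<forall>j\<ge>b. coeff P A' j = \<zero>"
     "a + b \<le> i + k"
    using assms(1) unfolding key_state_def by blast
  have polys: "A \<in> carrier P" "B \<in> carrier P" "A' \<in> carrier P" "B' \<in> carrier P"
    using S(1,2) by (auto simp: interpolates_def)
  let ?A = "e' i \<odot>\<^bsub>P\<^esub> A \<ominus>\<^bsub>P\<^esub> e i \<odot>\<^bsub>P\<^esub> A'" and ?B = "e' i \<odot>\<^bsub>P\<^esub> B \<ominus>\<^bsub>P\<^esub> e i \<odot>\<^bsub>P\<^esub> B'"
  have A0: "e i \<otimes> coeff P A' j = \<zero>" if "a \<le> j" for j
    using pick S(9) that ei polys by auto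
  have B0: "e i \<otimes> coeff P B' j = \<zero>" if "a < j + k" for j
    using pick S(8) that ei polys by auto
  have "interpolates \<alpha> w n (Suc i) ?A ?B f g"
    using S(1,2) \<alpha> w i ei new(3,4) by (intro interpolates_combine) (auto simp: R.m_comm)
  moreover have "interpolates \<alpha> w n (Suc i) (times_root (\<alpha> i) A') (times_root (\<alpha> i) B') f' g'"
    using S(2) \<alpha> w i new(1,2) by (rule interpolates_times_root)
  moreover have "coeff P ?A a \<noteq> \<zero>"
    using A0[of a] S(3) nz ei polys by (auto simp: R.integral_iff a_minus_def)
  moreover have "\<forall>j>a. coeff P ?A j = \<zero>"
    using A0 S(4) ei polys by (simp add: a_minus_def)
  moreover have "\<forall>j. a < j + k \<longrightarrow> coeff P ?B j = \<zero>"
    using B0 S(5) ei polys by (simp add: a_minus_def)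
  moreover have "coeff P (times_root (\<alpha> i) B') (Suc b - k) \<noteq> \<zero>"
    using S(6,7,8) ei polys by (simp add: coeff_times_root a_minus_def Suc_diff_le)
  moreover have "\<forall>j. Suc b < j + k \<longrightarrow> coeff P (times_root (\<alpha> i) B') j = \<zero>"
    using S(6,8) ei polys by (auto simp: coeff_times_root a_minus_def)
  moreover have "\<forall>j\<ge>Suc b. coeff P (times_root (\<alpha> i) A') j = \<zero>"
    using S(9) ei polys by (auto simp: coeff_times_root a_minus_def)
  ultimately show ?thesis
    unfolding key_state_def using S(6,10) by (intro exI conjI) (assumption | simp)+
qed

lemma key_state_skip:
  assumes "key_state \<alpha> w n k i a b e l e' l'" "e i = \<zero>" "e' i = \<zero>"
  shows "key_state \<alpha> w n k (Suc i) a b e l e' l'"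
proof -
  have "interpolates \<alpha> w n (Suc i) A B f g"
    if "interpolates \<alpha> w n i A B f g" "f i = \<zero>" for A B f g
    using that by (auto simp: interpolates_def less_Suc_eq)
  with assms show ?thesis
    unfolding key_state_def by (metis add_Suc le_SucI)
qed

text \<open>
  At every position where \<open>w\<close> is correct, \<open>A + B f\<close> takes the value \<open>A(\<alpha> x) + B(\<alpha> x) w x = 0\<close>. With at
  least \<open>m\<close> such positions it is therefore zero, having degree below \<open>m\<close>.
\<close>

lemma interpolates_cofactor:
  assumes Q: "interpolates \<alpha> w n n A B e l"
    and \<alpha>: "inj_on \<alpha> {..<n}" "\<alpha> ` {..<n} \<subseteq> carrier R" and fin: "finite (carrier R)"
    and w: "w ` {..<n} \<subseteq> carrier R"
    and f: "f \<in> carrier P" "\<forall>j\<ge>k. coeff P f j = \<zero>"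
    and A: "\<forall>j\<ge>m. coeff P A j = \<zero>" and B: "\<forall>j. m < j + k \<longrightarrow> coeff P B j = \<zero>"
    and m: "m \<le> card {x. x < n \<and> w x = value_at f (\<alpha> x)}"
  shows "A \<oplus>\<^bsub>P\<^esub> B \<otimes>\<^bsub>P\<^esub> f = \<zero>\<^bsub>P\<^esub>"
proof (rule zero_if_many_roots[OF _ _ fin, where m = m])
  have polys: "A \<in> carrier P" "B \<in> carrier P"
    using Q by (auto simp: interpolates_def)
  show "A \<oplus>\<^bsub>P\<^esub> B \<otimes>\<^bsub>P\<^esub> f \<in> carrier P"
    using polys f(1) by simp
  show "coeff P (A \<oplus>\<^bsub>P\<^esub> B \<otimes>\<^bsub>P\<^esub> f) j = \<zero>" if j: "m \<le> j" for j
  proof -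
    have "coeff P B i \<otimes> coeff P f (j - i) = \<zero>" for i
    proof (cases "m < i + k")
      case True
      then show ?thesis using B polys f(1) by simp
    next
      case False
      then have "k \<le> j - i" using j by linarith
      then show ?thesis using f polys by simp
    qed
    then show ?thesis
      using A j polys f(1) by simp
  qed
  show "inj_on \<alpha> {x. x < n \<and> w x = value_at f (\<alpha> x)}"
    using \<alpha>(1) by (rule inj_on_subset) auto
  show "\<alpha> ` {x. x < n \<and> w x = value_at f (\<alpha> x)} \<subseteq> carrier R"
    using \<alpha>(2) by auto
  show "value_at (A \<oplus>\<^bsub>P\<^esub> B \<otimes>\<^bsub>P\<^esub> f) (\<alpha> x) = \<zero>" if "x \<in> {x. x < n \<and> w x = value_at f (\<alpha> x)}" for x
  proof -
    have "\<zero> = value_at A (\<alpha> x) \<oplus> value_at B (\<alpha> x) \<otimes> w x"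
      using Q that by (auto simp: interpolates_def)
    moreover have "\<alpha> x \<in> carrier R"
      using \<alpha>(2) that by auto
    ultimately show ?thesis
      using that polys f(1) by auto
  qed
  show "m \<le> card {x. x < n \<and> w x = value_at f (\<alpha> x)}" by (rule m)
qed

text \<open>
  At least \<open>(n + k) / 2\<close> positions are correct, and \<open>a + b\<close> is at most \<open>n + k\<close>. If \<open>a < b\<close>, the first
  pair would be small enough to give \<open>A + B f = 0\<close>, in contradiction to its leading term \<open>X^a\<close>, which
  \<open>B f\<close> does not reach. So the second pair is the small one, \<open>A' = - B' f\<close>, and \<open>B'\<close> has at most
  \<open>b - k\<close> roots because its leading coefficient is known not to vanish.
\<close>

lemma key_state_locates_errors:
  assumes S: "key_state \<alpha> w n k n a b e l e' l'"
    and \<alpha>: "inj_on \<alpha> {..<n}" "\<alpha> ` {..<n} \<subseteq> carrier R" and fin: "finite (carrier R)"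
    and w: "w ` {..<n} \<subseteq> carrier R" and k: "1 \<le> k" "k \<le> n"
    and f: "f \<in> carrier P" "\<forall>j\<ge>k. coeff P f j = \<zero>"
    and errors: "card {x. x < n \<and> w x \<noteq> value_at f (\<alpha> x)} \<le> (n - k) div 2"
  shows "\<forall>x<n. l' x \<noteq> \<zero> \<longrightarrow> w x = value_at f (\<alpha> x)"
    and "k \<le> card {x. x < n \<and> l' x \<noteq> \<zero>}"
proof -
  obtain A B A' B' where S: "interpolates \<alpha> w n n A B e l" "interpolates \<alpha> w n n A' B' e' l'"
     "coeff P A a \<noteq> \<zero>" "\<forall>j>a. coeff P A j = \<zero>" "\<forall>j. a < j + k \<longrightarrow> coeff P B j = \<zero>"
     "k \<le> b" "coeff P B' (b - k) \<noteq> \<zero>"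
     "\<forall>j. b < j + k \<longrightarrow> coeff P B' j = \<zero>" "\<forall>j\<ge>b. coeff P A' j = \<zero>"
     "a + b \<le> n + k"
    using S unfolding key_state_def by blast
  have polys: "A \<in> carrier P" "B \<in> carrier P" "A' \<in> carrier P" "B' \<in> carrier P"
    using S(1,2) by (auto simp: interpolates_def)
  let ?G = "{x. x < n \<and> w x = value_at f (\<alpha> x)}" and ?E = "{x. x < n \<and> w x \<noteq> value_at f (\<alpha> x)}"
  have "card ?G + card ?E = card (?G \<union> ?E)"
    by (rule card_Un_disjoint[symmetric]) auto
  also have "?G \<union> ?E = {..<n}"
    by auto
  finally have G: "n + k \<le> 2 * card ?G"
    using errors k(2) by simp
  have "b \<le> a"
  proof (rule ccontr)
    assume "\<not> b \<le> a"
    then have "Suc a \<le> card ?G"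
      using G S(10) by linarith
    then have zero: "A \<oplus>\<^bsub>P\<^esub> B \<otimes>\<^bsub>P\<^esub> f = \<zero>\<^bsub>P\<^esub>"
      using S(1,4,5) \<alpha> fin w f by (intro interpolates_cofactor[where m = "Suc a"]) auto
    \<comment> \<open>The product \<open>B f\<close> has no term of degree \<open>a\<close>, so the leading term of \<open>A\<close> survives.\<close>
    have "coeff P B i \<otimes> coeff P f (a - i) = \<zero>" for i
    proof (cases "a < i + k")
      case True
      then show ?thesis using S(5) polys f(1) by simp
    next
      case False
      then have "k \<le> a - i" by linarith
      then show ?thesis using f polys by simp
    qed
    then have "coeff P (A \<oplus>\<^bsub>P\<^esub> B \<otimes>\<^bsub>P\<^esub> f) a = coeff P A a"
      using polys f(1) by simp
    with zero S(3) show False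
      by simp
  qed
  then have b: "b \<le> card ?G"
    using G S(10) by linarith
  then have zero: "A' \<oplus>\<^bsub>P\<^esub> B' \<otimes>\<^bsub>P\<^esub> f = \<zero>\<^bsub>P\<^esub>"
    using S(2,8,9) \<alpha> fin w f by (intro interpolates_cofactor[where m = b]) auto
  show "\<forall>x<n. l' x \<noteq> \<zero> \<longrightarrow> w x = value_at f (\<alpha> x)"
  proof (intro allI impI)
    fix x assume x: "x < n" and nz: "l' x \<noteq> \<zero>"
    have c: "\<alpha> x \<in> carrier R" "w x \<in> carrier R"
      using \<alpha> w x by auto
    then have c': "value_at A' (\<alpha> x) \<in> carrier R"
      "value_at B' (\<alpha> x) \<in> carrier R" "value_at f (\<alpha> x) \<in> carrier R"
      using polys f(1) by auto
    have nz': "value_at B' (\<alpha> x) \<noteq> \<zero>"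
      and 1: "value_at A' (\<alpha> x) \<oplus> value_at B' (\<alpha> x) \<otimes> w x = \<zero>"
      using S(2) x nz by (auto simp: interpolates_def)
    have "value_at A' (\<alpha> x) \<oplus> value_at B' (\<alpha> x) \<otimes> value_at f (\<alpha> x) = \<zero>"
      using arg_cong[OF zero, of "\<lambda>p. value_at p (\<alpha> x)"] polys f(1) c by simp
    with 1 c c' nz' show "w x = value_at f (\<alpha> x)"
      by (metis R.minus_equality R.a_comm R.m_closed R.m_lcancel)
  qed
  have "n - (b - k) \<le> card {x. x < n \<and> l' x \<noteq> \<zero>}"
  proof (rule ccontr)
    let ?Z = "{x. x < n \<and> l' x = \<zero>}"
    assume "\<not> ?thesis"
    moreover have "card ?Z + card {x. x < n \<and> l' x \<noteq> \<zero>} = card (?Z \<union> {x. x < n \<and> l' x \<noteq> \<zero>})"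
      by (rule card_Un_disjoint[symmetric]) auto
    moreover have "?Z \<union> {x. x < n \<and> l' x \<noteq> \<zero>} = {..<n}"
      by auto
    ultimately have "Suc (b - k) \<le> card ?Z"
      by simp
    moreover have "value_at B' (\<alpha> x) = \<zero>" if "x \<in> ?Z" for x
      using that S(2) by (auto simp: interpolates_def)
    ultimately have "B' = \<zero>\<^bsub>P\<^esub>"
      using polys(4) S(6,8) fin \<alpha>
      by (intro zero_if_many_roots[where m = "Suc (b - k)" and X = ?Z and \<alpha> = \<alpha>])
         (auto intro: inj_on_subset)
    with S(7) show False
      by simp
  qed
  moreover have "2 * b \<le> n + k"
    using \<open>b \<le> a\<close> S(10) by linarith
  ultimately show "k \<le> card {x. x < n \<and> l' x \<noteq> \<zero>}"
    using S(6) k(2) by linarith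
qed

section \<open>Newton interpolation\<close>

text \<open>
  \<open>p\<close> holds the values of the polynomial of degree below \<open>card G\<close> that agrees with \<open>w\<close> on \<open>G\<close>. The
  polynomial behind \<open>h\<close> is Newton's next basis polynomial, the product of the factors \<open>X - \<alpha> x\<close> for \<open>x\<close>
  in \<open>G\<close>; what matters of it is its degree and its roots among the points.
\<close>

definition newton_state :: "(nat \<Rightarrow> 'a) \<Rightarrow> (nat \<Rightarrow> 'a) \<Rightarrow> nat \<Rightarrow> nat set \<Rightarrow>
    (nat \<Rightarrow> 'a) \<Rightarrow> (nat \<Rightarrow> 'a) \<Rightarrow> bool" where
  "newton_state \<alpha> w n G p h \<longleftrightarrow> (\<exists>p' h'. p' \<in> carrier P \<and> h' \<in> carrier P \<and>
     (\<forall>x<n. p x = value_at p' (\<alpha> x) \<and> h x = value_at h' (\<alpha> x)) \<and>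
     (\<forall>j\<ge>card G. coeff P p' j = \<zero>) \<and> (\<forall>j>card G. coeff P h' j = \<zero>) \<and>
     (\<forall>x\<in>G. p x = w x) \<and> (\<forall>x<n. h x = \<zero> \<longleftrightarrow> x \<in> G))"

lemma newton_state_initial:
  assumes "\<alpha> ` {..<n} \<subseteq> carrier R" "\<And>x. x < n \<Longrightarrow> p x = \<zero> \<and> h x = \<one>"
  shows "newton_state \<alpha> w n {} p h"
proof -
  show ?thesis
    unfolding newton_state_def using assms
    by (intro exI[of _ "\<zero>\<^bsub>P\<^esub>"] exI[of _ "\<one>\<^bsub>P\<^esub>"]) (auto simp: image_subset_iff)
qed

lemma newton_state_values_closed:
  assumes "newton_state \<alpha> w n G p h" "\<alpha> ` {..<n} \<subseteq> carrier R" "x < n"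
  shows "p x \<in> carrier R" "h x \<in> carrier R"
  using assms by (auto simp: newton_state_def image_subset_iff)

text \<open>
  Since \<open>h\<close> vanishes on \<open>G\<close>, adding a multiple of it keeps the values that are already right; the
  factor \<open>c\<close> is Newton's divided difference, which corrects the value at \<open>i\<close>.
\<close>

lemma newton_state_insert:
  assumes S: "newton_state \<alpha> w n G p h"
    and \<alpha>: "inj_on \<alpha> {..<n}" "\<alpha> ` {..<n} \<subseteq> carrier R" and w: "w i \<in> carrier R"
    and G: "G \<subseteq> {..<n}" "i < n" "i \<notin> G"
    and c: "c \<in> carrier R" "c \<otimes> h i = w i \<ominus> p i"
    and new: "\<And>x. x < n \<Longrightarrow> p' x = p x \<oplus> c \<otimes> h x"
      "\<And>x. x < n \<Longrightarrow> h' x = h x \<otimes> (\<alpha> x \<ominus> \<alpha> i)"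
  shows "newton_state \<alpha> w n (insert i G) p' h'"
proof -
  obtain u v where S: "u \<in> carrier P" "v \<in> carrier P"
    "\<forall>x<n. p x = value_at u (\<alpha> x) \<and> h x = value_at v (\<alpha> x)"
    "\<forall>j\<ge>card G. coeff P u j = \<zero>" "\<forall>j>card G. coeff P v j = \<zero>"
    "\<forall>x\<in>G. p x = w x" "\<forall>x<n. h x = \<zero> \<longleftrightarrow> x \<in> G"
    using S unfolding newton_state_def by blast
  have closed: "p x \<in> carrier R" "h x \<in> carrier R" "\<alpha> x \<in> carrier R" if "x < n" for x
    using S(1,2,3) \<alpha>(2) that by (auto simp: image_subset_iff)
  have card: "card (insert i G) = Suc (card G)"
    using G finite_subset[OF G(1) finite_lessThan] by (simp add: card_insert_if)
  have "\<forall>x<n. p' x = value_at (u \<oplus>\<^bsub>P\<^esub> c \<odot>\<^bsub>P\<^esub> v) (\<alpha> x) \<and> h' x = value_at (times_root (\<alpha> i) v) (\<alpha> x)"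
    using S(1-3) c(1) closed G(2) by (simp add: new value_times_root)
  moreover have "\<forall>j\<ge>card (insert i G). coeff P (u \<oplus>\<^bsub>P\<^esub> c \<odot>\<^bsub>P\<^esub> v) j = \<zero>"
    using S(1,2,4,5) c(1) card by simp
  moreover have "\<forall>j>card (insert i G). coeff P (times_root (\<alpha> i) v) j = \<zero>"
    using S(2,5) card closed(3)[OF G(2)] by (auto simp: coeff_times_root a_minus_def)
  moreover have "\<forall>x\<in>insert i G. p' x = w x"
  proof
    fix x assume "x \<in> insert i G"
    moreover have "p i \<oplus> (w i \<ominus> p i) = w i"
      using w closed(1)[OF G(2)] by algebra
    then have "p' i = w i"
      using G(2) c(2) by (simp add: new)
    moreover have "p' x = w x" if "x \<in> G"
    proof -
      have "x < n" using that G(1) by auto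
      moreover have "h x = \<zero>" using S(7) that \<open>x < n\<close> by simp
      moreover have "p x = w x" using S(6) that by simp
      ultimately show ?thesis using c(1) closed(1)[of x] by (simp add: new)
    qed
    ultimately show "p' x = w x"
      by auto
  qed
  moreover have "\<forall>x<n. h' x = \<zero> \<longleftrightarrow> x \<in> insert i G"
  proof (intro allI impI)
    fix x assume x: "x < n"
    have "\<alpha> x \<ominus> \<alpha> i = \<zero> \<longleftrightarrow> x = i"
      using \<alpha>(1) x G(2) closed by (auto dest: inj_onD)
    then show "h' x = \<zero> \<longleftrightarrow> x \<in> insert i G"
      using S(7) x closed G(2) by (auto simp: new R.integral_iff)
  qed
  moreover have "u \<oplus>\<^bsub>P\<^esub> c \<odot>\<^bsub>P\<^esub> v \<in> carrier P" "times_root (\<alpha> i) v \<in> carrier P"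
    using S(1,2) c(1) closed(3)[OF G(2)] by auto
  ultimately show ?thesis
    unfolding newton_state_def by blast
qed

text \<open>
  Both the interpolant and \<open>f\<close> have degree below \<open>card G\<close>, and they agree at the \<open>card G\<close> points of \<open>G\<close>.
\<close>

lemma newton_state_recovers:
  assumes S: "newton_state \<alpha> w n G p h"
    and \<alpha>: "inj_on \<alpha> {..<n}" "\<alpha> ` {..<n} \<subseteq> carrier R" and fin: "finite (carrier R)"
    and G: "G \<subseteq> {..<n}" "k \<le> card G" "\<forall>x\<in>G. w x = value_at f (\<alpha> x)"
    and f: "f \<in> carrier P" "\<forall>j\<ge>k. coeff P f j = \<zero>" and x: "x < n"
  shows "p x = value_at f (\<alpha> x)"
proof -
  obtain u where S: "u \<in> carrier P" "\<forall>x<n. p x = value_at u (\<alpha> x)"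
    "\<forall>j\<ge>card G. coeff P u j = \<zero>" "\<forall>x\<in>G. p x = w x"
    using S unfolding newton_state_def by blast
  have "u \<ominus>\<^bsub>P\<^esub> f = \<zero>\<^bsub>P\<^esub>"
  proof (rule zero_if_many_roots[where m = "card G" and X = G and \<alpha> = \<alpha>])
    show "value_at (u \<ominus>\<^bsub>P\<^esub> f) (\<alpha> y) = \<zero>" if y: "y \<in> G" for y
    proof -
      have "y < n" "\<alpha> y \<in> carrier R" using y G(1) \<alpha>(2) by auto
      moreover have "value_at u (\<alpha> y) = value_at f (\<alpha> y)"
        using S(2,4) G(3) y \<open>y < n\<close> by metis
      ultimately show ?thesis
        using S(1) f(1) by simp
    qed
  qed (use S f fin \<alpha> G in \<open>auto intro: inj_on_subset simp: image_subset_iff subset_iff\<close>)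
  then have "u = f"
    using S(1) f(1) by simp
  then show ?thesis
    using S(2) x by simp
qed

end

section \<open>Reasoning about running time\<close>

text \<open>
  Straight-line code is executed symbolically: \<open>effect\<close> computes the successor state of a one-step
  instruction and \<open>enabled\<close> says that the step is possible. They cover the instructions that occur in
  the decoder.
\<close>

fun effect :: "'b ring \<Rightarrow> program \<Rightarrow> 'b state \<Rightarrow> 'b state" where
  "effect F (Index_Const i c) s = put_index s i c"
| "effect F (Index_Add i j l) s = put_index s i (fst s j + fst s l)"
| "effect F (Field_One x) s = put s x \<one>\<^bsub>F\<^esub>"
| "effect F (Field_Copy x y) s = put s x (get s y)"
| "effect F (Field_Add x y z) s = put s x (get s y \<oplus>\<^bsub>F\<^esub> get s z)"
| "effect F (Field_Sub x y z) s = put s x (get s y \<ominus>\<^bsub>F\<^esub> get s z)"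
| "effect F (Field_Mult x y z) s = put s x (get s y \<otimes>\<^bsub>F\<^esub> get s z)"
| "effect F (Field_Div x y z) s = put s x (get s y \<otimes>\<^bsub>F\<^esub> inv\<^bsub>F\<^esub> (get s z))"
| "effect F _ s = s"

fun enabled :: "'b ring \<Rightarrow> program \<Rightarrow> 'b state \<Rightarrow> bool" where
  "enabled F (Field_Div x y z) s \<longleftrightarrow> get s z \<noteq> \<zero>\<^bsub>F\<^esub>"
| "enabled F (Index_Const i c) s \<longleftrightarrow> True"
| "enabled F (Index_Add i j l) s \<longleftrightarrow> True"
| "enabled F (Field_One x) s \<longleftrightarrow> True"
| "enabled F (Field_Copy x y) s \<longleftrightarrow> True"
| "enabled F (Field_Add x y z) s \<longleftrightarrow> True"
| "enabled F (Field_Sub x y z) s \<longleftrightarrow> True"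
| "enabled F (Field_Mult x y z) s \<longleftrightarrow> True"
| "enabled F _ s \<longleftrightarrow> False"

lemma run_effect: "enabled F c s \<Longrightarrow> run F c s 1 (effect F c s)"
  by (cases c) (auto simp del: One_nat_def intro: run.intros)

fun block :: "program list \<Rightarrow> program" where
  "block [] = Skip"
| "block (c # cs) = Seq c (block cs)"

text \<open>
  The time is only bounded from above, so that the two branches of a conditional and the rounds of a
  loop can be given a common budget.
\<close>

definition reaches :: "'b ring \<Rightarrow> program \<Rightarrow> 'b state \<Rightarrow> nat \<Rightarrow> ('b state \<Rightarrow> bool) \<Rightarrow> bool" where
  "reaches F P s T Q \<longleftrightarrow> (\<exists>t s'. run F P s t s' \<and> t \<le> T \<and> Q s')"

lemma reaches_mono: "reaches F P s t R \<Longrightarrow> t \<le> T \<Longrightarrow> (\<And>s'. R s' \<Longrightarrow> Q s') \<Longrightarrow> reaches F P s T Q"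
  unfolding reaches_def by (meson order.trans)

lemma reaches_Seq:
  assumes "reaches F P s t R" "\<And>s'. R s' \<Longrightarrow> reaches F P' s' u Q"
  shows "reaches F (Seq P P') s (t + u) Q"
  using assms unfolding reaches_def by (meson add_mono run.intros(12))

lemma reaches_Cond:
  assumes "holds s b \<Longrightarrow> reaches F P s t Q" "\<not> holds s b \<Longrightarrow> reaches F P' s t Q"
  shows "reaches F (Cond b P P') s (Suc t) Q"
  using assms unfolding reaches_def by (meson Suc_le_mono run.intros(13,14))

fun all_enabled :: "'b ring \<Rightarrow> program list \<Rightarrow> 'b state \<Rightarrow> bool" where
  "all_enabled F [] s \<longleftrightarrow> True"
| "all_enabled F (c # cs) s \<longleftrightarrow> enabled F c s \<and> all_enabled F cs (effect F c s)"

lemma all_enabled_append [simp]: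
  "all_enabled F (cs @ ds) s \<longleftrightarrow> all_enabled F cs s \<and> all_enabled F ds (fold (effect F) cs s)"
  by (induction cs arbitrary: s) auto

lemma run_block: "all_enabled F cs s \<Longrightarrow> run F (block cs) s (length cs) (fold (effect F) cs s)"
proof (induction cs arbitrary: s)
  case Nil
  then show ?case by (simp add: run.intros(11))
next
  case (Cons c cs)
  then have "run F c s 1 (effect F c s)"
    "run F (block cs) (effect F c s) (length cs) (fold (effect F) cs (effect F c s))"
    using run_effect[of F c s] by auto
  from run.intros(12)[OF this] show ?case by simp
qed

lemma reaches_block:
  assumes "all_enabled F cs s" "length cs \<le> T" "Q (fold (effect F) cs s)"
  shows "reaches F (block cs) s T Q"
  using run_block[OF assms(1)] assms(2,3) unfolding reaches_def by blast

lemma reaches_While: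
  assumes test: "\<And>i s. i \<le> n \<Longrightarrow> I i s \<Longrightarrow> holds s b \<longleftrightarrow> i < n"
    and body: "\<And>i s. i < n \<Longrightarrow> I i s \<Longrightarrow> reaches F P s t (I (Suc i))"
    and start: "I 0 s"
  shows "reaches F (While b P) s (n * Suc t + 1) (I n)"
proof -
  have "reaches F (While b P) s ((n - i) * Suc t + 1) (I n)" if "i \<le> n" "I i s" for i s
    using that
  proof (induction i arbitrary: s rule: inc_induct)
    case base
    then show ?case
      using test[of n s] run.intros(15)[of s b F P] unfolding reaches_def by fastforce
  next
    case (step i)
    obtain t1 s1 where 1: "run F P s t1 s1" "t1 \<le> t" "I (Suc i) s1"
      using body[OF step.hyps(2) step.prems] unfolding reaches_def by blast
    obtain t2 s2 where 2: "run F (While b P) s1 t2 s2" "t2 \<le> (n - Suc i) * Suc t + 1" "I n s2"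
      using step.IH[OF 1(3)] unfolding reaches_def by blast
    have "holds s b"
      using test[of i s] step.hyps step.prems by simp
    then have "run F (While b P) s (Suc (t1 + t2)) s2"
      using 1(1) 2(1) by (rule run.intros(16))
    moreover have "n - i = Suc (n - Suc i)"
      using step.hyps by simp
    then have "Suc (t1 + t2) \<le> (n - i) * Suc t + 1"
      using 1(2) 2(2) by simp
    ultimately show ?case
      using 2(3) unfolding reaches_def by blast
  qed
  from this[of 0] start show ?thesis by simp
qed

text \<open>
  Runs \<open>cs\<close> for every position \<open>x < n\<close>. Register 0 holds \<open>n\<close>, register 5 the current position and
  register 3 the constant one.
\<close>

definition sweep :: "program list \<Rightarrow> program" where
  "sweep cs = Seq (block [Index_Const 5 0])
     (While (Index_Less 5 0) (block (cs @ [Index_Add 5 5 3])))"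

text \<open>
  In the state before pass \<open>l\<close> the columns to the left of \<open>l\<close> already have their final contents \<open>\<nu>\<close>.
  So the effect of the whole sweep is found by executing the body once on such a mixed memory.
\<close>

lemma reaches_sweep:
  assumes n: "\<iota> 0 = n" and one: "\<iota> 3 = 1"
    and cs: "\<And>l s. l < n \<Longrightarrow> s = (\<iota>(5 := l), \<lambda>a x. if x < l then \<nu> a x else \<mu> a x) \<Longrightarrow>
       all_enabled F cs s \<and>
       fold (effect F) cs s = (\<iota>(5 := l), \<lambda>a x. if x < Suc l then \<nu> a x else \<mu> a x)"
  shows "reaches F (sweep cs) (\<iota>, \<mu>) (n * (length cs + 2) + 2)
     (\<lambda>s. s = (\<iota>(5 := n), \<lambda>a x. if x < n then \<nu> a x else \<mu> a x))"
proof -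
  let ?I = "\<lambda>l s. s = (\<iota>(5 := l), \<lambda>a x. if x < l then \<nu> a x else \<mu> a x)"
  have "reaches F (While (Index_Less 5 0) (block (cs @ [Index_Add 5 5 3]))) (\<iota>(5 := 0), \<mu>)
    (n * Suc (length cs + 1) + 1) (?I n)"
  proof (rule reaches_While)
    show "reaches F (block (cs @ [Index_Add 5 5 3])) s (length cs + 1) (?I (Suc l))"
      if "l < n" "?I l s" for l s
      using cs[OF that] by (intro reaches_block) (auto simp: one)
  qed (use n in auto)
  moreover have "reaches F (block [Index_Const 5 0]) (\<iota>, \<mu>) 1 (\<lambda>s. s = (\<iota>(5 := 0), \<mu>))"
    by (intro reaches_block) auto
  ultimately have "reaches F (sweep cs) (\<iota>, \<mu>) (1 + (n * Suc (length cs + 1) + 1)) (?I n)"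
    unfolding sweep_def by (intro reaches_Seq[where R = "\<lambda>s. s = (\<iota>(5 := 0), \<mu>)"]) simp_all
  then show ?thesis
    by (rule reaches_mono) auto
qed

section \<open>The decoder\<close>

text \<open>
  Register 0 holds \<open>n\<close>, registers 2 and 1 the numbers \<open>a\<close> and \<open>b\<close> of \<open>key_state\<close>; the initial
  contents \<open>k\<close> of register 1 is already the right value of \<open>b\<close>. Register 3 holds the constant one,
  registers 4 and 5 are the counters of the outer and the inner loops. Array 0 contains the received
  word and array 1 the evaluation points. Arrays 4 and 5 contain the vectors \<open>e\<close> and \<open>l\<close> of the first
  pair, arrays 6 and 7 those of the second one. Arrays 2 and 3 contain the vectors \<open>p\<close> and \<open>h\<close> of the
  Newton interpolation; thus the codeword ends up in array 2. Array 10 is scratch space, the cells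
  \<open>(8, 3)\<close> and \<open>(9, 3)\<close> hold scalars, and \<open>(11, 3)\<close> is never written and serves as the constant zero.
\<close>

text \<open>
  The residual and locator of the pair to be multiplied by \<open>X - \<alpha> i\<close> are in arrays \<open>u\<close> and \<open>bu\<close>, those
  of the other pair in \<open>v\<close> and \<open>bv\<close>. The residuals at the point \<open>i\<close> are read from copies in arrays
  \<open>d\<close> and \<open>e\<close>, since the pass itself overwrites them at position \<open>i\<close>.
\<close>

definition raise_body :: "nat \<Rightarrow> nat \<Rightarrow> nat \<Rightarrow> nat \<Rightarrow> nat \<Rightarrow> nat \<Rightarrow> program list" where
  "raise_body u bu v bv d e =
    [Field_Mult (v, 5) (d, 3) (v, 5), Field_Mult (10, 5) (e, 3) (u, 5),
     Field_Sub (v, 5) (v, 5) (10, 5),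
     Field_Mult (bv, 5) (d, 3) (bv, 5), Field_Mult (10, 5) (e, 3) (bu, 5),
     Field_Sub (bv, 5) (bv, 5) (10, 5),
     Field_Sub (10, 5) (1, 5) (1, 4), Field_Mult (u, 5) (u, 5) (10, 5),
     Field_Mult (bu, 5) (bu, 5) (10, 5)]"

text \<open>
  The array numbers are restricted to the two assignments of roles that occur, because with concrete
  numbers all questions of aliasing are decided by computation.
\<close>

lemma reaches_raise:
  assumes "\<iota> 0 = n" "\<iota> 3 = 1"
    "[u, bu, v, bv, d, e] = [4, 5, 6, 7, 8, 9] \<or> [u, bu, v, bv, d, e] = [6, 7, 4, 5, 9, 8]"
  shows "reaches F (sweep (raise_body u bu v bv d e)) (\<iota>, \<mu>) (n * 11 + 2)
     (\<lambda>s. s = (\<iota>(5 := n), \<lambda>a x. if x < n then (\<mu>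
       (v := \<lambda>x. \<mu> d 1 \<otimes>\<^bsub>F\<^esub> \<mu> v x \<ominus>\<^bsub>F\<^esub> \<mu> e 1 \<otimes>\<^bsub>F\<^esub> \<mu> u x,
        bv := \<lambda>x. \<mu> d 1 \<otimes>\<^bsub>F\<^esub> \<mu> bv x \<ominus>\<^bsub>F\<^esub> \<mu> e 1 \<otimes>\<^bsub>F\<^esub> \<mu> bu x,
        u := \<lambda>x. \<mu> u x \<otimes>\<^bsub>F\<^esub> (\<mu> 1 x \<ominus>\<^bsub>F\<^esub> \<mu> 1 (\<iota> 4)),
        bu := \<lambda>x. \<mu> bu x \<otimes>\<^bsub>F\<^esub> (\<mu> 1 x \<ominus>\<^bsub>F\<^esub> \<mu> 1 (\<iota> 4)),
        10 := \<lambda>x. \<mu> 1 x \<ominus>\<^bsub>F\<^esub> \<mu> 1 (\<iota> 4))) a x else \<mu> a x))"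
    (is "reaches F _ _ _ (\<lambda>s. s = (_, \<lambda>a x. if x < n then ?\<nu> a x else \<mu> a x))")
proof -
  let ?cs = "raise_body u bu v bv d e"
  have "all_enabled F ?cs s \<and>
    fold (effect F) ?cs s = (\<iota>(5 := l), \<lambda>a x. if x < Suc l then ?\<nu> a x else \<mu> a x)"
    if "l < n" and s: "s = (\<iota>(5 := l), \<lambda>a x. if x < l then ?\<nu> a x else \<mu> a x)" for l s
  proof -
    have u: "\<iota> 3 = 1" by fact
    from assms(3) show ?thesis
      by (elim disjE) (simp add: s u raise_body_def, intro ext, simp add: less_Suc_eq)+
  qed
  then have "reaches F (sweep ?cs) (\<iota>, \<mu>) (n * (length ?cs + 2) + 2)
     (\<lambda>s. s = (\<iota>(5 := n), \<lambda>a x. if x < n then ?\<nu> a x else \<mu> a x))"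
    by (rule reaches_sweep[where F=F and cs = ?cs and \<nu> = ?\<nu>, OF assms(1,2)])
  then show ?thesis
    by (rule reaches_mono) (simp_all add: raise_body_def)
qed

definition raise_first :: program where
  "raise_first = Seq (sweep (raise_body 4 5 6 7 8 9)) (block [Index_Add 2 2 3, Index_Add 4 4 3])"

definition raise_second :: program where
  "raise_second = Seq (sweep (raise_body 6 7 4 5 9 8)) (block [Index_Add 1 1 3, Index_Add 4 4 3])"

text \<open>
  When both residuals vanish, neither pair has to change. When exactly one vanishes, the pair
  with the nonzero residual must be multiplied, whatever the degrees are.
\<close>

definition locate_step :: program where
  "locate_step = Seq (block [Field_Copy (8, 3) (4, 4), Field_Copy (9, 3) (6, 4)])
     (Cond (Field_Eq (8, 3) (11, 3))
       (Cond (Field_Eq (9, 3) (11, 3)) (block [Index_Add 4 4 3]) raise_second)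
       (Cond (Field_Eq (9, 3) (11, 3)) raise_first
         (Cond (Index_Less 2 1) raise_first raise_second)))"

definition newton_body :: "program list" where
  "newton_body = [Field_Mult (10, 5) (8, 3) (3, 5), Field_Add (2, 5) (2, 5) (10, 5),
     Field_Sub (10, 5) (1, 5) (1, 4), Field_Mult (3, 5) (3, 5) (10, 5)]"

definition newton_step :: program where
  "newton_step = Cond (Field_Eq (7, 4) (11, 3)) (block [Index_Add 4 4 3])
     (Seq (block [Field_Sub (8, 3) (0, 4) (2, 4), Field_Div (8, 3) (8, 3) (3, 4)])
       (Seq (sweep newton_body) (block [Index_Add 4 4 3])))"

text \<open>
  The first pair starts as \<open>(1, 0)\<close> and the second one as \<open>(0, 1)\<close>, so their residuals are the constant
  one and the received word. Arrays 2 and 5, which must be zero, are so from the start.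
\<close>

definition initial_body :: "program list" where
  "initial_body = [Field_One (3, 5), Field_One (4, 5), Field_Copy (6, 5) (0, 5), Field_One (7, 5)]"

definition decoder :: program where
  "decoder = Seq (block [Index_Const 3 1]) (Seq (sweep initial_body)
     (Seq (While (Index_Less 4 0) locate_step)
     (Seq (block [Index_Const 4 0]) (While (Index_Less 4 0) newton_step))))"

text \<open>
  A locating round takes at most \<open>11 n + 10\<close> steps including the loop test and an interpolating round
  at most \<open>6 n + 7\<close>. The initial pass takes \<open>6 n + 2\<close> steps; two assignments to index registers and the
  last tests of the two loops make up the rest.
\<close>

definition decoding_time :: "nat \<Rightarrow> nat" where
  "decoding_time n = 17 * n\<^sup>2 + 23 * n + 6"

lemma reaches_initial_sweep:
  assumes "\<iota> 0 = n" "\<iota> 3 = 1"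
  shows "reaches F (sweep initial_body) (\<iota>, \<mu>) (n * 6 + 2)
     (\<lambda>s. s = (\<iota>(5 := n), \<lambda>a x. if x < n then (\<mu>
       (3 := \<lambda>x. \<one>\<^bsub>F\<^esub>, 4 := \<lambda>x. \<one>\<^bsub>F\<^esub>, 6 := \<mu> 0, 7 := \<lambda>x. \<one>\<^bsub>F\<^esub>)) a x else \<mu> a x))"
    (is "reaches F _ _ _ (\<lambda>s. s = (_, \<lambda>a x. if x < n then ?\<nu> a x else \<mu> a x))")
proof -
  let ?cs = initial_body
  have "all_enabled F ?cs s \<and>
    fold (effect F) ?cs s = (\<iota>(5 := l), \<lambda>a x. if x < Suc l then ?\<nu> a x else \<mu> a x)"
    if "l < n" and s: "s = (\<iota>(5 := l), \<lambda>a x. if x < l then ?\<nu> a x else \<mu> a x)" for l s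
    by (simp add: s initial_body_def, intro ext, simp add: less_Suc_eq)
  then have "reaches F (sweep ?cs) (\<iota>, \<mu>) (n * (length ?cs + 2) + 2)
     (\<lambda>s. s = (\<iota>(5 := n), \<lambda>a x. if x < n then ?\<nu> a x else \<mu> a x))"
    by (rule reaches_sweep[where F=F and cs = ?cs and \<nu> = ?\<nu>, OF assms(1,2)])
  then show ?thesis
    by (rule reaches_mono) (simp_all add: initial_body_def)
qed

lemma reaches_newton_sweep:
  assumes "\<iota> 0 = n" "\<iota> 3 = 1"
  shows "reaches F (sweep newton_body) (\<iota>, \<mu>) (n * 6 + 2)
     (\<lambda>s. s = (\<iota>(5 := n), \<lambda>a x. if x < n then (\<mu>
       (2 := \<lambda>x. \<mu> 2 x \<oplus>\<^bsub>F\<^esub> \<mu> 8 1 \<otimes>\<^bsub>F\<^esub> \<mu> 3 x,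
        3 := \<lambda>x. \<mu> 3 x \<otimes>\<^bsub>F\<^esub> (\<mu> 1 x \<ominus>\<^bsub>F\<^esub> \<mu> 1 (\<iota> 4)),
        10 := \<lambda>x. \<mu> 1 x \<ominus>\<^bsub>F\<^esub> \<mu> 1 (\<iota> 4))) a x else \<mu> a x))"
    (is "reaches F _ _ _ (\<lambda>s. s = (_, \<lambda>a x. if x < n then ?\<nu> a x else \<mu> a x))")
proof -
  let ?cs = newton_body
  have "all_enabled F ?cs s \<and>
    fold (effect F) ?cs s = (\<iota>(5 := l), \<lambda>a x. if x < Suc l then ?\<nu> a x else \<mu> a x)"
    if "l < n" and s: "s = (\<iota>(5 := l), \<lambda>a x. if x < l then ?\<nu> a x else \<mu> a x)" for l s
    using assms(2) by (simp add: s newton_body_def, intro ext, simp add: less_Suc_eq)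
  then have "reaches F (sweep ?cs) (\<iota>, \<mu>) (n * (length ?cs + 2) + 2)
     (\<lambda>s. s = (\<iota>(5 := n), \<lambda>a x. if x < n then ?\<nu> a x else \<mu> a x))"
    by (rule reaches_sweep[where F=F and cs = ?cs and \<nu> = ?\<nu>, OF assms(1,2)])
  then show ?thesis
    by (rule reaches_mono) (simp_all add: newton_body_def)
qed

section \<open>Correctness of the decoder\<close>

locale finite_field_polynomials = UP_domain R P
  for R :: "'a ring" (structure) and P (structure) +
  assumes is_field: "field R" and finite_field: "finite (carrier R)"
begin

fun locating :: "(nat \<Rightarrow> 'a) \<Rightarrow> (nat \<Rightarrow> 'a) \<Rightarrow> nat \<Rightarrow> nat \<Rightarrow> nat \<Rightarrow> 'a state \<Rightarrow> bool" where
  "locating \<alpha> w n k i (\<iota>, \<mu>) \<longleftrightarrow> \<iota> 0 = n \<and> \<iota> 3 = 1 \<and> \<iota> 4 = i \<and>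
     (\<forall>x<n. \<mu> 0 x = w x \<and> \<mu> 1 x = \<alpha> x \<and> \<mu> 2 x = \<zero> \<and> \<mu> 3 x = \<one>) \<and> \<mu> 11 1 = \<zero> \<and>
     key_state \<alpha> w n k i (\<iota> 2) (\<iota> 1) (\<mu> 4) (\<mu> 5) (\<mu> 6) (\<mu> 7)"

fun recovering :: "(nat \<Rightarrow> 'a) \<Rightarrow> (nat \<Rightarrow> 'a) \<Rightarrow> nat \<Rightarrow> (nat \<Rightarrow> 'a) \<Rightarrow> nat \<Rightarrow> 'a state \<Rightarrow> bool" where
  "recovering \<alpha> w n l i (\<iota>, \<mu>) \<longleftrightarrow> \<iota> 0 = n \<and> \<iota> 3 = 1 \<and> \<iota> 4 = i \<and>
     (\<forall>x<n. \<mu> 0 x = w x \<and> \<mu> 1 x = \<alpha> x \<and> \<mu> 7 x = l x) \<and> \<mu> 11 1 = \<zero> \<and>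
     newton_state \<alpha> w n {x. x < i \<and> l x \<noteq> \<zero>} (\<mu> 2) (\<mu> 3)"

text \<open>
  The hypotheses on \<open>\<mu> 8\<close> and \<open>\<mu> 9\<close> say that the residuals at the current point have been copied, as
  the first block of \<open>locate_step\<close> does.
\<close>

lemma reaches_raise_first:
  assumes S: "locating \<alpha> w n k i (\<iota>, \<mu>)"
    and \<alpha>: "\<alpha> ` {..<n} \<subseteq> carrier R" and w: "w ` {..<n} \<subseteq> carrier R" and i: "i < n"
    and loaded: "\<mu> 8 1 = \<mu> 4 i" "\<mu> 9 1 = \<mu> 6 i"
    and pick: "\<mu> 4 i \<noteq> \<zero>" "\<mu> 6 i = \<zero> \<or> \<iota> 2 < \<iota> 1"
  shows "reaches R raise_first (\<iota>, \<mu>) (n * 11 + 4) (locating \<alpha> w n k (Suc i))"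
proof -
  have S: "\<iota> 0 = n" "\<iota> 3 = 1" "\<iota> 4 = i"
    "\<forall>x<n. \<mu> 0 x = w x \<and> \<mu> 1 x = \<alpha> x \<and> \<mu> 2 x = \<zero> \<and> \<mu> 3 x = \<one>" "\<mu> 11 1 = \<zero>"
     "key_state \<alpha> w n k i (\<iota> 2) (\<iota> 1) (\<mu> 4) (\<mu> 5) (\<mu> 6) (\<mu> 7)"
    using S by simp_all
  have raise: "reaches R (sweep (raise_body 4 5 6 7 8 9)) (\<iota>, \<mu>) (n * 11 + 2)
     (\<lambda>s. s = (\<iota>(5 := n), \<lambda>a x. if x < n then (\<mu>
       (6 := \<lambda>x. \<mu> 8 1 \<otimes> \<mu> 6 x \<ominus> \<mu> 9 1 \<otimes> \<mu> 4 x,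
        7 := \<lambda>x. \<mu> 8 1 \<otimes> \<mu> 7 x \<ominus> \<mu> 9 1 \<otimes> \<mu> 5 x,
        4 := \<lambda>x. \<mu> 4 x \<otimes> (\<mu> 1 x \<ominus> \<mu> 1 (\<iota> 4)),
        5 := \<lambda>x. \<mu> 5 x \<otimes> (\<mu> 1 x \<ominus> \<mu> 1 (\<iota> 4)),
        10 := \<lambda>x. \<mu> 1 x \<ominus> \<mu> 1 (\<iota> 4))) a x else \<mu> a x))"
    using S(1,2) by (rule reaches_raise) simp
  have next_state: "key_state \<alpha> w n k (Suc i) (Suc (\<iota> 2)) (\<iota> 1)
     (\<lambda>x. if x < n then \<mu> 4 x \<otimes> (\<mu> 1 x \<ominus> \<mu> 1 i) else \<mu> 4 x)
     (\<lambda>x. if x < n then \<mu> 5 x \<otimes> (\<mu> 1 x \<ominus> \<mu> 1 i) else \<mu> 5 x)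
     (\<lambda>x. if x < n then \<mu> 8 1 \<otimes> \<mu> 6 x \<ominus> \<mu> 9 1 \<otimes> \<mu> 4 x else \<mu> 6 x)
     (\<lambda>x. if x < n then \<mu> 8 1 \<otimes> \<mu> 7 x \<ominus> \<mu> 9 1 \<otimes> \<mu> 5 x else \<mu> 7 x)"
    using S(6) \<alpha> w i pick by (rule key_state_raise_first) (use S(4) i loaded in auto)
  have "reaches R raise_first (\<iota>, \<mu>) (n * 11 + 2 + 2) (locating \<alpha> w n k (Suc i))"
    unfolding raise_first_def
  proof (rule reaches_Seq[OF raise], rule reaches_block, goal_cases)
    case (3 s')
    show ?case
      unfolding 3 using S next_state by (simp cong: if_cong)
  qed simp_all
  then show ?thesis by (rule reaches_mono) simp_all
qed

lemma reaches_raise_second: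
  assumes S: "locating \<alpha> w n k i (\<iota>, \<mu>)"
    and \<alpha>: "\<alpha> ` {..<n} \<subseteq> carrier R" and w: "w ` {..<n} \<subseteq> carrier R" and i: "i < n"
    and loaded: "\<mu> 8 1 = \<mu> 4 i" "\<mu> 9 1 = \<mu> 6 i"
    and pick: "\<mu> 6 i \<noteq> \<zero>" "\<mu> 4 i = \<zero> \<or> \<iota> 1 \<le> \<iota> 2"
  shows "reaches R raise_second (\<iota>, \<mu>) (n * 11 + 4) (locating \<alpha> w n k (Suc i))"
proof -
  have S: "\<iota> 0 = n" "\<iota> 3 = 1" "\<iota> 4 = i"
    "\<forall>x<n. \<mu> 0 x = w x \<and> \<mu> 1 x = \<alpha> x \<and> \<mu> 2 x = \<zero> \<and> \<mu> 3 x = \<one>" "\<mu> 11 1 = \<zero>"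
     "key_state \<alpha> w n k i (\<iota> 2) (\<iota> 1) (\<mu> 4) (\<mu> 5) (\<mu> 6) (\<mu> 7)"
    using S by simp_all
  have raise: "reaches R (sweep (raise_body 6 7 4 5 9 8)) (\<iota>, \<mu>) (n * 11 + 2)
     (\<lambda>s. s = (\<iota>(5 := n), \<lambda>a x. if x < n then (\<mu>
       (4 := \<lambda>x. \<mu> 9 1 \<otimes> \<mu> 4 x \<ominus> \<mu> 8 1 \<otimes> \<mu> 6 x,
        5 := \<lambda>x. \<mu> 9 1 \<otimes> \<mu> 5 x \<ominus> \<mu> 8 1 \<otimes> \<mu> 7 x,
        6 := \<lambda>x. \<mu> 6 x \<otimes> (\<mu> 1 x \<ominus> \<mu> 1 (\<iota> 4)),
        7 := \<lambda>x. \<mu> 7 x \<otimes> (\<mu> 1 x \<ominus> \<mu> 1 (\<iota> 4)),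
        10 := \<lambda>x. \<mu> 1 x \<ominus> \<mu> 1 (\<iota> 4))) a x else \<mu> a x))"
    using S(1,2) by (rule reaches_raise) simp
  have next_state: "key_state \<alpha> w n k (Suc i) (\<iota> 2) (Suc (\<iota> 1))
     (\<lambda>x. if x < n then \<mu> 9 1 \<otimes> \<mu> 4 x \<ominus> \<mu> 8 1 \<otimes> \<mu> 6 x else \<mu> 4 x)
     (\<lambda>x. if x < n then \<mu> 9 1 \<otimes> \<mu> 5 x \<ominus> \<mu> 8 1 \<otimes> \<mu> 7 x else \<mu> 5 x)
     (\<lambda>x. if x < n then \<mu> 6 x \<otimes> (\<mu> 1 x \<ominus> \<mu> 1 i) else \<mu> 6 x)
     (\<lambda>x. if x < n then \<mu> 7 x \<otimes> (\<mu> 1 x \<ominus> \<mu> 1 i) else \<mu> 7 x)"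
    using S(6) \<alpha> w i pick by (rule key_state_raise_second) (use S(4) i loaded in auto)
  have "reaches R raise_second (\<iota>, \<mu>) (n * 11 + 2 + 2) (locating \<alpha> w n k (Suc i))"
    unfolding raise_second_def
  proof (rule reaches_Seq[OF raise], rule reaches_block, goal_cases)
    case (3 s')
    show ?case
      unfolding 3 using S next_state by (simp cong: if_cong)
  qed simp_all
  then show ?thesis by (rule reaches_mono) simp_all
qed

lemma reaches_locate_step:
  assumes S: "locating \<alpha> w n k i s"
    and \<alpha>: "\<alpha> ` {..<n} \<subseteq> carrier R" and w: "w ` {..<n} \<subseteq> carrier R" and i: "i < n"
  shows "reaches R locate_step s (n * 11 + 9) (locating \<alpha> w n k (Suc i))"
proof -
  obtain \<iota> \<mu> where s: "s = (\<iota>, \<mu>)" by (cases s)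
  define \<mu>' where "\<mu>' = \<mu>(8 := (\<mu> 8)(1 := \<mu> 4 i), 9 := (\<mu> 9)(1 := \<mu> 6 i))"
  have load: "reaches R (block [Field_Copy (8, 3) (4, 4), Field_Copy (9, 3) (6, 4)]) s 2
    (\<lambda>s. s = (\<iota>, \<mu>'))"
    using S by (intro reaches_block) (simp_all add: s \<mu>'_def)
  have S': "locating \<alpha> w n k i (\<iota>, \<mu>')"
    using S by (simp add: s \<mu>'_def)
  have loaded: "\<mu>' 8 1 = \<mu>' 4 i" "\<mu>' 9 1 = \<mu>' 6 i"
    by (simp_all add: \<mu>'_def)
  have r: "\<iota> 3 = 1" "\<iota> 4 = i" "\<mu>' 11 1 = \<zero>"
    using S' by simp_all
  note first = reaches_raise_first[OF S' \<alpha> w i loaded]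
    and second = reaches_raise_second[OF S' \<alpha> w i loaded]
  have skip: "reaches R (block [Index_Add 4 4 3]) (\<iota>, \<mu>') (n * 11 + 4) (locating \<alpha> w n k (Suc i))"
    if "\<mu>' 4 i = \<zero>" "\<mu>' 6 i = \<zero>"
    using S' key_state_skip[of \<alpha> w n k i "\<iota> 2" "\<iota> 1" "\<mu>' 4" "\<mu>' 5" "\<mu>' 6" "\<mu>' 7"] that
    by (intro reaches_block) simp_all
  have tests: "holds (\<iota>, \<mu>') (Field_Eq (8, 3) (11, 3)) \<longleftrightarrow> \<mu>' 4 i = \<zero>"
    "holds (\<iota>, \<mu>') (Field_Eq (9, 3) (11, 3)) \<longleftrightarrow> \<mu>' 6 i = \<zero>"
    "holds (\<iota>, \<mu>') (Index_Less 2 1) \<longleftrightarrow> \<iota> 2 < \<iota> 1"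
    using r loaded by simp_all
  let ?Q = "locating \<alpha> w n k (Suc i)"
  have "reaches R (Cond (Field_Eq (9, 3) (11, 3)) (block [Index_Add 4 4 3]) raise_second)
      (\<iota>, \<mu>') (Suc (Suc (n * 11 + 4))) ?Q" if "\<mu>' 4 i = \<zero>"
    by (rule reaches_mono[OF reaches_Cond])
      (unfold tests, erule skip[OF that], erule second, use that in simp_all)
  moreover have "reaches R (Cond (Field_Eq (9, 3) (11, 3)) raise_first
         (Cond (Index_Less 2 1) raise_first raise_second)) (\<iota>, \<mu>') (Suc (Suc (n * 11 + 4))) ?Q"
    if 4: "\<mu>' 4 i \<noteq> \<zero>"
  proof (rule reaches_Cond; unfold tests)
    assume "\<mu>' 6 i = \<zero>"
    with 4 show "reaches R raise_first (\<iota>, \<mu>') (Suc (n * 11 + 4)) ?Q"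
      by (intro reaches_mono[OF first]) simp_all
  next
    assume 6: "\<mu>' 6 i \<noteq> \<zero>"
    show "reaches R (Cond (Index_Less 2 1) raise_first raise_second) (\<iota>, \<mu>') (Suc (n * 11 + 4)) ?Q"
      by (rule reaches_Cond; unfold tests) (use 4 6 in \<open>simp_all add: first second\<close>)
  qed
  ultimately have "reaches R (Cond (Field_Eq (8, 3) (11, 3))
       (Cond (Field_Eq (9, 3) (11, 3)) (block [Index_Add 4 4 3]) raise_second)
       (Cond (Field_Eq (9, 3) (11, 3)) raise_first
         (Cond (Index_Less 2 1) raise_first raise_second))) (\<iota>, \<mu>') (Suc (Suc (Suc (n * 11 + 4)))) ?Q"
    by (rule reaches_Cond; unfold tests)
  then have "reaches R locate_step s (2 + Suc (Suc (Suc (n * 11 + 4)))) ?Q"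
    unfolding locate_step_def by (intro reaches_Seq[OF load]) simp
  then show ?thesis
    by (rule reaches_mono) simp_all
qed

lemma reaches_newton_step:
  assumes S: "recovering \<alpha> w n l i s"
    and \<alpha>: "inj_on \<alpha> {..<n}" "\<alpha> ` {..<n} \<subseteq> carrier R" and w: "w ` {..<n} \<subseteq> carrier R"
    and i: "i < n"
  shows "reaches R newton_step s (n * 6 + 6) (recovering \<alpha> w n l (Suc i))"
proof -
  obtain \<iota> \<mu> where s: "s = (\<iota>, \<mu>)" by (cases s)
  let ?G = "{x. x < i \<and> l x \<noteq> \<zero>}"
  have S: "\<iota> 0 = n" "\<iota> 3 = 1" "\<iota> 4 = i"
    "\<forall>x<n. \<mu> 0 x = w x \<and> \<mu> 1 x = \<alpha> x \<and> \<mu> 7 x = l x" "\<mu> 11 1 = \<zero>"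
    "newton_state \<alpha> w n ?G (\<mu> 2) (\<mu> 3)"
    using S by (simp_all add: s)
  have "reaches R newton_step s (Suc (n * 6 + 5)) (recovering \<alpha> w n l (Suc i))"
    unfolding newton_step_def
  proof (rule reaches_Cond)
    assume "holds s (Field_Eq (7, 4) (11, 3))"
    then have "l i = \<zero>" using S i by (simp add: s)
    then have "{x. x < Suc i \<and> l x \<noteq> \<zero>} = ?G"
      by (auto simp: less_Suc_eq)
    with S show "reaches R (block [Index_Add 4 4 3]) s (n * 6 + 5) (recovering \<alpha> w n l (Suc i))"
      by (intro reaches_block) (simp_all add: s)
  next
    assume "\<not> holds s (Field_Eq (7, 4) (11, 3))"
    then have "l i \<noteq> \<zero>" using S i by (simp add: s)
    then have G: "{x. x < Suc i \<and> l x \<noteq> \<zero>} = insert i ?G"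
      by (auto simp: less_Suc_eq)
    have closed: "\<mu> 2 i \<in> carrier R" "\<mu> 3 i \<in> carrier R" "w i \<in> carrier R"
      using newton_state_values_closed[OF S(6) \<alpha>(2) i] w i by auto
    have nz: "\<mu> 3 i \<noteq> \<zero>"
      using S(6) i unfolding newton_state_def by blast
    then have unit: "\<mu> 3 i \<in> Units R"
      using closed(2) field.field_Units[OF is_field] by simp
    define c where "c = (w i \<ominus> \<mu> 2 i) \<otimes> inv \<mu> 3 i"
    have c: "c \<in> carrier R" "c \<otimes> \<mu> 3 i = w i \<ominus> \<mu> 2 i"
      using closed unit by (simp_all add: c_def R.m_assoc R.Units_l_inv)
    define \<mu>' where "\<mu>' = \<mu>(8 := (\<mu> 8)(1 := c))"
    have coeff: "reaches R (block [Field_Sub (8, 3) (0, 4) (2, 4), Field_Div (8, 3) (8, 3) (3, 4)]) s 2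
      (\<lambda>s. s = (\<iota>, \<mu>'))"
      using S i nz by (intro reaches_block) (simp_all add: s \<mu>'_def c_def)
    have add: "reaches R (sweep newton_body) (\<iota>, \<mu>') (n * 6 + 2)
     (\<lambda>s. s = (\<iota>(5 := n), \<lambda>a x. if x < n then (\<mu>'
       (2 := \<lambda>x. \<mu>' 2 x \<oplus> \<mu>' 8 1 \<otimes> \<mu>' 3 x,
        3 := \<lambda>x. \<mu>' 3 x \<otimes> (\<mu>' 1 x \<ominus> \<mu>' 1 (\<iota> 4)),
        10 := \<lambda>x. \<mu>' 1 x \<ominus> \<mu>' 1 (\<iota> 4))) a x else \<mu>' a x))"
      using S(1,2) by (rule reaches_newton_sweep)
    have next_state: "newton_state \<alpha> w n (insert i ?G)
      (\<lambda>x. if x < n then \<mu> 2 x \<oplus> c \<otimes> \<mu> 3 x else \<mu> 2 x)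
      (\<lambda>x. if x < n then \<mu> 3 x \<otimes> (\<mu> 1 x \<ominus> \<mu> 1 i) else \<mu> 3 x)"
      by (rule newton_state_insert[OF S(6) \<alpha> closed(3) _ i _ c]) (use S(4) i in auto)
    have step: "reaches R (Seq (sweep newton_body) (block [Index_Add 4 4 3])) (\<iota>, \<mu>') (n * 6 + 2 + 1)
      (recovering \<alpha> w n l (Suc i))"
    proof (rule reaches_Seq[OF add], rule reaches_block, goal_cases)
      case (3 s')
      show ?case
        unfolding 3 using S next_state by (simp add: \<mu>'_def G cong: if_cong)
    qed simp_all
    have "reaches R (Seq (block [Field_Sub (8, 3) (0, 4) (2, 4), Field_Div (8, 3) (8, 3) (3, 4)])
       (Seq (sweep newton_body) (block [Index_Add 4 4 3]))) s (2 + (n * 6 + 2 + 1))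
       (recovering \<alpha> w n l (Suc i))"
      using step by (intro reaches_Seq[OF coeff]) simp
    then show "reaches R (Seq (block [Field_Sub (8, 3) (0, 4) (2, 4), Field_Div (8, 3) (8, 3) (3, 4)])
       (Seq (sweep newton_body) (block [Index_Add 4 4 3]))) s (n * 6 + 5) (recovering \<alpha> w n l (Suc i))"
      by (rule reaches_mono) simp_all
  qed
  then show ?thesis
    by (rule reaches_mono) simp_all
qed

theorem decoder_correct:
  assumes \<alpha>: "inj_on \<alpha> {..<n}" "\<alpha> ` {..<n} \<subseteq> carrier R"
    and w: "w ` {..<n} \<subseteq> carrier R" and k: "1 \<le> k" "k \<le> n"
    and f: "f \<in> carrier P" "\<forall>j\<ge>k. coeff P f j = \<zero>"
    and errors: "card {x. x < n \<and> w x \<noteq> value_at f (\<alpha> x)} \<le> (n - k) div 2"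
  shows "reaches R decoder (initial_state R n k \<alpha> w) (decoding_time n)
    (\<lambda>(\<iota>, \<mu>). \<forall>x<n. \<mu> 2 x = value_at f (\<alpha> x))"
proof -
  obtain \<iota> \<mu> where s: "initial_state R n k \<alpha> w = (\<iota>, \<mu>)" by (cases "initial_state R n k \<alpha> w")
  have \<iota>: "\<iota> = (\<lambda>_. 0)(0 := n, 1 := k)"
    and \<mu>: "\<mu> = (\<lambda>_ _. \<zero>)(0 := (\<lambda>i. if i < n then w i else \<zero>), 1 := (\<lambda>i. if i < n then \<alpha> i else \<zero>))"
    using s by (auto simp: initial_state_def)
  have prepare: "reaches R (sweep initial_body) (\<iota>(3 := 1), \<mu>) (n * 6 + 2) (locating \<alpha> w n k 0)"
  proof (rule reaches_mono[OF reaches_initial_sweep])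
    fix s' assume s': "s' = (\<iota>(3 := 1, 5 := n), \<lambda>a x. if x < n then (\<mu>
       (3 := \<lambda>x. \<one>, 4 := \<lambda>x. \<one>, 6 := \<mu> 0, 7 := \<lambda>x. \<one>)) a x else \<mu> a x)"
    have "key_state \<alpha> w n k 0 0 k (\<lambda>x. if x < n then \<one> else \<zero>) (\<lambda>x. \<zero>)
      (\<lambda>x. if x < n then w x else \<zero>) (\<lambda>x. if x < n then \<one> else \<zero>)"
      using \<alpha>(2) w k(1) by (rule key_state_initial) auto
    then show "locating \<alpha> w n k 0 s'"
      unfolding s' by (simp add: \<iota> \<mu> cong: if_cong)
  qed (simp_all add: \<iota>)
  have locate: "reaches R (While (Index_Less 4 0) locate_step) s (n * Suc (n * 11 + 9) + 1)
      (locating \<alpha> w n k n)"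
    if "locating \<alpha> w n k 0 s" for s
    by (rule reaches_While[OF _ reaches_locate_step[OF _ \<alpha>(2) w] that]) (auto elim: locating.elims)
  have recover: "reaches R (Seq (block [Index_Const 4 0]) (While (Index_Less 4 0) newton_step)) s
      (1 + (n * Suc (n * 6 + 6) + 1)) (\<lambda>(\<iota>, \<mu>). \<forall>x<n. \<mu> 2 x = value_at f (\<alpha> x))"
    if located: "locating \<alpha> w n k n s" for s
  proof -
    obtain \<iota> \<mu> where s: "s = (\<iota>, \<mu>)" by (cases s)
    let ?G = "{x. x < n \<and> \<mu> 7 x \<noteq> \<zero>}"
    have "key_state \<alpha> w n k n (\<iota> 2) (\<iota> 1) (\<mu> 4) (\<mu> 5) (\<mu> 6) (\<mu> 7)"
      using located by (simp add: s)
    note correct = key_state_locates_errors[OF this \<alpha> finite_field w k f errors]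
    have "reaches R (block [Index_Const 4 0]) s 1 (recovering \<alpha> w n (\<mu> 7) 0)"
      using located newton_state_initial[OF \<alpha>(2), of "\<mu> 2" "\<mu> 3" w]
      by (intro reaches_block) (simp_all add: s)
    moreover have "reaches R (While (Index_Less 4 0) newton_step) s' (n * Suc (n * 6 + 6) + 1)
        (recovering \<alpha> w n (\<mu> 7) n)"
      if "recovering \<alpha> w n (\<mu> 7) 0 s'" for s'
      by (rule reaches_While[OF _ reaches_newton_step[OF _ \<alpha> w] that]) (auto elim: recovering.elims)
    ultimately have "reaches R (Seq (block [Index_Const 4 0]) (While (Index_Less 4 0) newton_step)) s
      (1 + (n * Suc (n * 6 + 6) + 1)) (recovering \<alpha> w n (\<mu> 7) n)"
      by (rule reaches_Seq)
    then show ?thesis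
    proof (rule reaches_mono)
      fix s' assume "recovering \<alpha> w n (\<mu> 7) n s'"
      moreover obtain \<iota>' \<mu>' where s': "s' = (\<iota>', \<mu>')" by (cases s')
      ultimately have "newton_state \<alpha> w n ?G (\<mu>' 2) (\<mu>' 3)" by simp
      from newton_state_recovers[OF this \<alpha> finite_field _ correct(2) _ f] correct(1)
      show "case s' of (\<iota>, \<mu>) \<Rightarrow> \<forall>x<n. \<mu> 2 x = value_at f (\<alpha> x)"
        by (auto simp: s')
    qed simp
  qed
  have "reaches R (block [Index_Const 3 1]) (initial_state R n k \<alpha> w) 1 (\<lambda>s. s = (\<iota>(3 := 1), \<mu>))"
    by (intro reaches_block) (simp_all add: s)
  moreover have "reaches R (Seq (sweep initial_body) (Seq (While (Index_Less 4 0) locate_step)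
     (Seq (block [Index_Const 4 0]) (While (Index_Less 4 0) newton_step)))) s'
     ((n * 6 + 2) + ((n * Suc (n * 11 + 9) + 1) + (1 + (n * Suc (n * 6 + 6) + 1))))
     (\<lambda>(\<iota>, \<mu>). \<forall>x<n. \<mu> 2 x = value_at f (\<alpha> x))" if "s' = (\<iota>(3 := 1), \<mu>)" for s'
    unfolding that
    by (rule reaches_Seq[OF prepare]) (rule reaches_Seq[OF locate recover])
  ultimately have "reaches R decoder (initial_state R n k \<alpha> w)
     (1 + ((n * 6 + 2) + ((n * Suc (n * 11 + 9) + 1) + (1 + (n * Suc (n * 6 + 6) + 1)))))
     (\<lambda>(\<iota>, \<mu>). \<forall>x<n. \<mu> 2 x = value_at f (\<alpha> x))"
    unfolding decoder_def by (rule reaches_Seq)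
  then show ?thesis
    by (rule reaches_mono) (simp_all add: decoding_time_def power2_eq_square algebra_simps)
qed

end

lemma decoding_time_quadratic: "(\<lambda>n. real (decoding_time n)) \<in> O(\<lambda>n. real n ^ 2)"
proof (rule bigoI[where c = 46])
  have "norm (real (decoding_time n)) \<le> 46 * norm (real n ^ 2)" if "1 \<le> n" for n
  proof -
    have "n \<le> n ^ 2" "1 \<le> n ^ 2"
      using that by (simp_all add: power2_eq_square)
    then have "decoding_time n \<le> 46 * n ^ 2"
      unfolding decoding_time_def by linarith
    then have "real (decoding_time n) \<le> real (46 * n ^ 2)"
      by (rule of_nat_mono)
    then show ?thesis by simp
  qed
  then show "\<forall>\<^sub>F n in sequentially. norm (real (decoding_time n)) \<le> 46 * norm (real n ^ 2)"
    by (rule eventually_sequentiallyI)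
qed

section \<open>The Reed-Solomon code over the alphabet\<close>

locale alphabet = finite_field_polynomials R P
  for R :: "'b ring" (structure) and P (structure) +
  fixes D :: "'a monoid" and \<psi> :: "'a \<Rightarrow> 'b"
  assumes group: "group D" and iso: "\<psi> \<in> iso D (add_monoid R)"
begin

lemma bij: "bij_betw \<psi> (carrier D) (carrier R)"
  using iso by (simp add: iso_def)

lemma \<psi>_closed [simp]: "x \<in> carrier D \<Longrightarrow> \<psi> x \<in> carrier R"
  using bij by (auto dest: bij_betwE)

lemma \<psi>_mult: "x \<in> carrier D \<Longrightarrow> y \<in> carrier D \<Longrightarrow> \<psi> (x \<otimes>\<^bsub>D\<^esub> y) = \<psi> x \<oplus> \<psi> y"
  using iso by (simp add: iso_def hom_def)

lemma \<psi>_eq_iff: "x \<in> carrier D \<Longrightarrow> y \<in> carrier D \<Longrightarrow> \<psi> x = \<psi> y \<longleftrightarrow> x = y"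
  using bij by (meson bij_betw_imp_inj_on inj_on_eq_iff)

definition symbol :: "'b \<Rightarrow> 'a" where
  "symbol = inv_into (carrier D) \<psi>"

lemma symbol_closed [simp]: "v \<in> carrier R \<Longrightarrow> symbol v \<in> carrier D"
  using bij bij_betw_inv_into bij_betwE unfolding symbol_def by metis

lemma \<psi>_symbol [simp]: "v \<in> carrier R \<Longrightarrow> \<psi> (symbol v) = v"
  using bij unfolding symbol_def by (rule bij_betw_inv_into_right)

lemma hamming_distance_eq:
  assumes "x \<in> carrier (word_group D n)" "y \<in> carrier (word_group D n)"
  shows "hamming_distance D n x y = card {i. i < n \<and> \<psi> (x i) \<noteq> \<psi> (y i)}"
proof -
  interpret G: group D by (rule group)
  have "x i \<otimes>\<^bsub>D\<^esub> inv\<^bsub>D\<^esub> (y i) = \<one>\<^bsub>D\<^esub> \<longleftrightarrow> \<psi> (x i) = \<psi> (y i)" if "i < n" for i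
  proof -
    have "x i \<in> carrier D" "y i \<in> carrier D"
      using assms that by (auto simp: PiE_iff)
    then show ?thesis
      by (metis G.inv_equality G.inv_inv G.inv_closed G.r_inv \<psi>_eq_iff)
  qed
  then have "{i. i < n \<and> x i \<otimes>\<^bsub>D\<^esub> inv\<^bsub>D\<^esub> (y i) \<noteq> \<one>\<^bsub>D\<^esub>} = {i. i < n \<and> \<psi> (x i) \<noteq> \<psi> (y i)}"
    by auto
  then show ?thesis
    by (simp add: hamming_distance_def)
qed

text \<open>
  The elements of \<open>UP R\<close> are coefficient functions, so this function is itself a polynomial.
\<close>

definition message_poly :: "nat \<Rightarrow> (nat \<Rightarrow> 'a) \<Rightarrow> nat \<Rightarrow> 'b" where
  "message_poly k m = (\<lambda>j. if j < k then \<psi> (m j) else \<zero>)"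

lemma message_poly_closed [simp]:
  assumes "m \<in> carrier (word_group D k)"
  shows "message_poly k m \<in> carrier P"
proof -
  have "message_poly k m \<in> up R"
  proof (rule mem_upI)
    show "message_poly k m j \<in> carrier R" for j
      using assms by (auto simp: message_poly_def PiE_iff)
    show "\<exists>n. bound \<zero> n (message_poly k m)"
      by (intro exI[of _ k] bound.intro) (simp add: message_poly_def)
  qed
  then show ?thesis by (simp add: P_def UP_def)
qed

lemma coeff_message_poly:
  assumes "m \<in> carrier (word_group D k)"
  shows "coeff P (message_poly k m) j = (if j < k then \<psi> (m j) else \<zero>)"
  using message_poly_closed[OF assms] by (simp add: P_def UP_def message_poly_def)

text \<open>
  All polynomials of degree below \<open>k\<close> arise from messages. This is where the code gets its full
  dimension and, through \<open>root_polynomial_exists\<close>, its words of least weight.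
\<close>

lemma message_poly_surj:
  assumes "p \<in> carrier P" "\<forall>j\<ge>k. coeff P p j = \<zero>"
  obtains m where "m \<in> carrier (word_group D k)" "message_poly k m = p"
proof
  let ?m = "\<lambda>j\<in>{..<k}. symbol (coeff P p j)"
  show m: "?m \<in> carrier (word_group D k)"
    using assms(1) by auto
  show "message_poly k ?m = p"
    using assms m by (intro up_eqI message_poly_closed) (auto simp: coeff_message_poly)
qed

lemma message_poly_inj:
  assumes "m \<in> carrier (word_group D k)" "m' \<in> carrier (word_group D k)"
    "message_poly k m = message_poly k m'"
  shows "m = m'"
proof (rule PiE_ext)
  show "m \<in> (\<Pi>\<^sub>E i\<in>{..<k}. carrier D)" "m' \<in> (\<Pi>\<^sub>E i\<in>{..<k}. carrier D)"
    using assms(1,2) by simp_all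
  show "m j = m' j" if "j \<in> {..<k}" for j
  proof -
    have "\<psi> (m j) = \<psi> (m' j)"
      using fun_cong[OF assms(3), of j] that by (simp add: message_poly_def)
    moreover have "m j \<in> carrier D" "m' j \<in> carrier D"
      using assms(1,2) that by (auto simp: PiE_iff)
    ultimately show ?thesis by (simp add: \<psi>_eq_iff)
  qed
qed

definition encode :: "(nat \<Rightarrow> 'b) \<Rightarrow> nat \<Rightarrow> nat \<Rightarrow> (nat \<Rightarrow> 'a) \<Rightarrow> nat \<Rightarrow> 'a" where
  "encode \<alpha> n k m = (\<lambda>i\<in>{..<n}. symbol (value_at (message_poly k m) (\<alpha> i)))"

context
  fixes \<alpha> :: "nat \<Rightarrow> 'b" and n k :: nat
  assumes \<alpha>: "inj_on \<alpha> {..<n}" "\<alpha> ` {..<n} \<subseteq> carrier R"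
    and k: "1 \<le> k" "k \<le> n"
begin

lemma encode_closed [simp]:
  assumes "m \<in> carrier (word_group D k)"
  shows "encode \<alpha> n k m \<in> carrier (word_group D n)"
  using \<alpha>(2) message_poly_closed[OF assms] by (auto simp: encode_def)

lemma \<psi>_encode:
  assumes "m \<in> carrier (word_group D k)" "i < n"
  shows "\<psi> (encode \<alpha> n k m i) = value_at (message_poly k m) (\<alpha> i)"
  using \<alpha>(2) message_poly_closed[OF assms(1)] assms(2) by (auto simp: encode_def)

lemma encode_hom: "encode \<alpha> n k \<in> hom (word_group D k) (word_group D n)"
proof (rule homI)
  interpret K: group "word_group D k" using group by simp
  interpret N: group "word_group D n" using group by simp
  fix m m' assume m: "m \<in> carrier (word_group D k)" "m' \<in> carrier (word_group D k)"
  then have mm': "m \<otimes>\<^bsub>word_group D k\<^esub> m' \<in> carrier (word_group D k)"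
    by (rule K.m_closed)
  have "coeff P (message_poly k (m \<otimes>\<^bsub>word_group D k\<^esub> m')) j =
      coeff P (message_poly k m \<oplus>\<^bsub>P\<^esub> message_poly k m') j" for j
    using m mm' by (auto simp: coeff_message_poly PiE_iff \<psi>_mult simp del: carrier_product_group)
      (auto simp: \<psi>_mult PiE_iff)
  then have sum: "message_poly k (m \<otimes>\<^bsub>word_group D k\<^esub> m') = message_poly k m \<oplus>\<^bsub>P\<^esub> message_poly k m'"
    using m mm' by (intro up_eqI) (simp_all del: carrier_product_group mult_product_group)
  show "encode \<alpha> n k (m \<otimes>\<^bsub>word_group D k\<^esub> m') = encode \<alpha> n k m \<otimes>\<^bsub>word_group D n\<^esub> encode \<alpha> n k m'"
  proof (rule PiE_ext)
    show "encode \<alpha> n k (m \<otimes>\<^bsub>word_group D k\<^esub> m') \<in> (\<Pi>\<^sub>E i\<in>{..<n}. carrier D)"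
      using encode_closed[OF mm'] by simp
    show "encode \<alpha> n k m \<otimes>\<^bsub>word_group D n\<^esub> encode \<alpha> n k m' \<in> (\<Pi>\<^sub>E i\<in>{..<n}. carrier D)"
      using N.m_closed[OF encode_closed[OF m(1)] encode_closed[OF m(2)]] by simp
    fix i assume i: "i \<in> {..<n}"
    have c: "encode \<alpha> n k m i \<in> carrier D" "encode \<alpha> n k m' i \<in> carrier D"
      "encode \<alpha> n k (m \<otimes>\<^bsub>word_group D k\<^esub> m') i \<in> carrier D"
      using encode_closed[OF m(1)] encode_closed[OF m(2)] encode_closed[OF mm'] i
      by (simp_all only: carrier_product_group PiE_iff)
    have "\<psi> (encode \<alpha> n k (m \<otimes>\<^bsub>word_group D k\<^esub> m') i) = \<psi> (encode \<alpha> n k m i \<otimes>\<^bsub>D\<^esub> encode \<alpha> n k m' i)"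
      using i \<alpha>(2) m message_poly_closed[OF m(1)] message_poly_closed[OF m(2)]
      by (subst \<psi>_mult[OF c(1,2)]) (simp add: \<psi>_encode[OF mm'] \<psi>_encode sum image_subset_iff
          del: carrier_product_group mult_product_group)
    then have "encode \<alpha> n k (m \<otimes>\<^bsub>word_group D k\<^esub> m') i = encode \<alpha> n k m i \<otimes>\<^bsub>D\<^esub> encode \<alpha> n k m' i"
      using c group by (subst (asm) \<psi>_eq_iff) (auto intro: group.is_monoid monoid.m_closed)
    then show "encode \<alpha> n k (m \<otimes>\<^bsub>word_group D k\<^esub> m') i =
        (encode \<alpha> n k m \<otimes>\<^bsub>word_group D n\<^esub> encode \<alpha> n k m') i"
      using i by simp
  qed
qed (rule encode_closed)

lemma encode_distance:
  assumes m: "m \<in> carrier (word_group D k)" "m' \<in> carrier (word_group D k)"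
  shows "hamming_distance D n (encode \<alpha> n k m) (encode \<alpha> n k m') =
    card {i. i < n \<and> value_at (message_poly k m) (\<alpha> i) \<noteq> value_at (message_poly k m') (\<alpha> i)}"
proof -
  have "{i. i < n \<and> \<psi> (encode \<alpha> n k m i) \<noteq> \<psi> (encode \<alpha> n k m' i)} =
    {i. i < n \<and> value_at (message_poly k m) (\<alpha> i) \<noteq> value_at (message_poly k m') (\<alpha> i)}"
    using m by (auto simp: \<psi>_encode simp del: carrier_product_group)
  then show ?thesis
    using hamming_distance_eq[OF encode_closed encode_closed, OF m] by simp
qed

lemma encode_distance_ge:
  assumes m: "m \<in> carrier (word_group D k)" "m' \<in> carrier (word_group D k)" and neq: "m \<noteq> m'"
  shows "n - k + 1 \<le> hamming_distance D n (encode \<alpha> n k m) (encode \<alpha> n k m')"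
proof (rule ccontr)
  let ?p = "message_poly k m" and ?q = "message_poly k m'"
  let ?Z = "{i. i < n \<and> value_at ?p (\<alpha> i) = value_at ?q (\<alpha> i)}"
  let ?N = "{i. i < n \<and> value_at ?p (\<alpha> i) \<noteq> value_at ?q (\<alpha> i)}"
  have pq: "?p \<in> carrier P" "?q \<in> carrier P"
    using m by (simp_all del: carrier_product_group)
  assume "\<not> ?thesis"
  moreover have "card ?Z + card ?N = card (?Z \<union> ?N)"
    by (rule card_Un_disjoint[symmetric]) auto
  moreover have "?Z \<union> ?N = {..<n}"
    by auto
  ultimately have "k \<le> card ?Z"
    using k encode_distance[OF m] by simp
  moreover have "value_at (?p \<ominus>\<^bsub>P\<^esub> ?q) (\<alpha> i) = \<zero>" if "i \<in> ?Z" for i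
  proof -
    have "\<alpha> i \<in> carrier R" using \<alpha>(2) that by auto
    then show ?thesis using pq that by simp
  qed
  ultimately have "?p \<ominus>\<^bsub>P\<^esub> ?q = \<zero>\<^bsub>P\<^esub>"
    using \<alpha> finite_field pq m
    by (intro zero_if_many_roots[where m = k and X = ?Z and \<alpha> = \<alpha>])
      (auto simp: coeff_message_poly a_minus_def simp del: carrier_product_group intro: inj_on_subset)
  then have "?p = ?q"
    using pq by simp
  with message_poly_inj[OF m] neq show False
    by simp
qed

lemma encode_inj: "inj_on (encode \<alpha> n k) (carrier (word_group D k))"
proof (rule inj_onI, rule ccontr)
  fix m m' assume m: "m \<in> carrier (word_group D k)" "m' \<in> carrier (word_group D k)"
    and eq: "encode \<alpha> n k m = encode \<alpha> n k m'" and neq: "m \<noteq> m'"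
  have "hamming_distance D n (encode \<alpha> n k m) (encode \<alpha> n k m') = 0"
    using hamming_distance_eq[OF encode_closed encode_closed, OF m] eq by simp
  with encode_distance_ge[OF m neq] show False
    by simp
qed

text \<open>
  The zero word and the word of a polynomial vanishing at exactly \<open>k - 1\<close> of the points.
\<close>

lemma encode_distance_attained:
  obtains m m' where "m \<in> carrier (word_group D k)" "m' \<in> carrier (word_group D k)"
    "hamming_distance D n (encode \<alpha> n k m) (encode \<alpha> n k m') = n - k + 1"
proof -
  have "k - 1 \<le> n"
    using k by simp
  then obtain p where p: "p \<in> carrier P" "\<forall>j>k - 1. coeff P p j = \<zero>"
    "\<forall>i<n. value_at p (\<alpha> i) = \<zero> \<longleftrightarrow> i < k - 1"
    using root_polynomial_exists[OF \<alpha>] by blast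
  then have "\<forall>j\<ge>k. coeff P p j = \<zero>"
    using k by auto
  then obtain m where m: "m \<in> carrier (word_group D k)" "message_poly k m = p"
    using message_poly_surj[OF p(1)] by metis
  obtain m' where m': "m' \<in> carrier (word_group D k)" "message_poly k m' = \<zero>\<^bsub>P\<^esub>"
    using message_poly_surj[of "\<zero>\<^bsub>P\<^esub>" k] by auto
  have "\<alpha> i \<in> carrier R" if "i < n" for i
    using \<alpha>(2) that by auto
  then have "{i. i < n \<and> value_at p (\<alpha> i) \<noteq> value_at \<zero>\<^bsub>P\<^esub> (\<alpha> i)} = {k - 1..<n}"
    using p(3) by auto
  then have "hamming_distance D n (encode \<alpha> n k m) (encode \<alpha> n k m') = n - k + 1"
    using encode_distance[OF m(1) m'(1)] m(2) m'(2) k by simp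
  with m(1) m'(1) that show ?thesis by blast
qed

lemma code_minimum_distance:
  "minimum_distance D n (encode \<alpha> n k ` carrier (word_group D k)) = n - k + 1"
  unfolding minimum_distance_def
proof (rule Min_eqI)
  let ?C = "encode \<alpha> n k ` carrier (word_group D k)"
  let ?S = "{hamming_distance D n x y |x y. x \<in> ?C \<and> y \<in> ?C \<and> x \<noteq> y}"
  have "hamming_distance D n x y \<le> n" for x y
    unfolding hamming_distance_def
    by (rule order.trans[OF card_mono[of "{..<n}"]]) auto
  then have "?S \<subseteq> {..n}" by auto
  then show "finite ?S"
    by (rule finite_subset) simp
  show "n - k + 1 \<le> d" if "d \<in> ?S" for d
    using that encode_distance_ge by auto
  obtain m m' where m: "m \<in> carrier (word_group D k)" "m' \<in> carrier (word_group D k)"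
    "hamming_distance D n (encode \<alpha> n k m) (encode \<alpha> n k m') = n - k + 1"
    by (rule encode_distance_attained)
  have "encode \<alpha> n k m \<noteq> encode \<alpha> n k m'"
  proof
    assume "encode \<alpha> n k m = encode \<alpha> n k m'"
    then show False
      using m(3) hamming_distance_eq[OF encode_closed encode_closed, OF m(1,2)] by simp
  qed
  then show "n - k + 1 \<in> ?S"
    using m by (intro CollectI exI[of _ "encode \<alpha> n k m"] exI[of _ "encode \<alpha> n k m'"] conjI imageI)
      simp_all
qed

lemma code_decodable:
  "decodes_in_time decoder (decoding_time n) D R \<psi> n k \<alpha> (encode \<alpha> n k ` carrier (word_group D k))"
  unfolding decodes_in_time_def
proof (intro ballI impI)
  fix c r assume c: "c \<in> encode \<alpha> n k ` carrier (word_group D k)"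
    and r: "r \<in> carrier (word_group D n)"
    and "hamming_distance D n r c \<le>
      (minimum_distance D n (encode \<alpha> n k ` carrier (word_group D k)) - 1) div 2"
  then have dist: "hamming_distance D n r c \<le> (n - k) div 2"
    by (simp add: code_minimum_distance del: carrier_product_group)
  obtain m where m: "m \<in> carrier (word_group D k)" "c = encode \<alpha> n k m"
    using c by blast
  have "{i. i < n \<and> \<psi> (r i) \<noteq> \<psi> (c i)} = {i. i < n \<and> \<psi> (r i) \<noteq> value_at (message_poly k m) (\<alpha> i)}"
    using \<psi>_encode[OF m(1)] m(2) by auto
  then have "card {i. i < n \<and> \<psi> (r i) \<noteq> value_at (message_poly k m) (\<alpha> i)} \<le> (n - k) div 2"
    using dist hamming_distance_eq[OF r encode_closed[OF m(1)]] m(2) by simp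
  moreover have "(\<lambda>i. \<psi> (r i)) ` {..<n} \<subseteq> carrier R"
    using PiE_mem[of r "{..<n}" "\<lambda>_. carrier D"] r by (simp add: image_subset_iff)
  ultimately have "reaches R decoder (initial_state R n k \<alpha> (\<lambda>i. \<psi> (r i))) (decoding_time n)
    (\<lambda>(\<iota>, \<mu>). \<forall>i<n. \<mu> 2 i = value_at (message_poly k m) (\<alpha> i))"
    using \<alpha> k m(1)
    by (intro decoder_correct) (simp_all add: coeff_message_poly del: carrier_product_group)
  then obtain t \<iota> \<mu> where "run R decoder (initial_state R n k \<alpha> (\<lambda>i. \<psi> (r i))) t (\<iota>, \<mu>)"
    "t \<le> decoding_time n" "\<forall>i<n. \<mu> 2 i = value_at (message_poly k m) (\<alpha> i)"
    unfolding reaches_def by auto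
  then show "\<exists>t \<iota> \<mu>. run R decoder (initial_state R n k \<alpha> (\<lambda>i. \<psi> (r i))) t (\<iota>, \<mu>) \<and>
      t \<le> decoding_time n \<and> (\<forall>i<n. \<mu> 2 i = \<psi> (c i))"
    using \<psi>_encode[OF m(1)] m(2) by auto
qed

end

theorem code_exists:
  assumes k: "1 \<le> k" "k \<le> n" "n \<le> order R"
  shows "\<exists>C. algebraic_code D n C \<and> has_dimension D C k \<and> minimum_distance D n C = n - k + 1 \<and>
    (\<exists>\<alpha>. (\<forall>i<n. \<alpha> i \<in> carrier R) \<and> decodes_in_time decoder (decoding_time n) D R \<psi> n k \<alpha> C)"
proof -
  obtain \<alpha> where "bij_betw \<alpha> {0..<card (carrier R)} (carrier R)"
    using ex_bij_betw_nat_finite[OF finite_field] by blast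
  moreover have "{..<n} \<subseteq> {0..<card (carrier R)}"
    using k(3) by (auto simp: order_def)
  ultimately have \<alpha>: "inj_on \<alpha> {..<n}" "\<alpha> ` {..<n} \<subseteq> carrier R"
    by (auto simp: bij_betw_def intro: inj_on_subset)
  let ?C = "encode \<alpha> n k ` carrier (word_group D k)"
  have fin: "finite (carrier D)"
    using bij finite_field by (simp add: bij_betw_finite)
  have "algebraic_code D n ?C"
    unfolding algebraic_code_def
  proof (intro exI conjI)
    show "group (word_group D k)" using group by simp
    show "finite (carrier (word_group D k))" using fin by (simp add: finite_PiE)
  qed (rule encode_hom[OF \<alpha> k(1,2)] encode_inj[OF \<alpha> k(1,2)] refl)+
  moreover have "has_dimension D ?C k"
    unfolding has_dimension_def card_image[OF encode_inj[OF \<alpha> k(1,2)]]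
    by (simp add: card_PiE order_def)
  ultimately show ?thesis
    using code_minimum_distance[OF \<alpha> k(1,2)] code_decodable[OF \<alpha> k(1,2)] \<alpha>(2)
    by (intro exI[of _ ?C] exI[of _ \<alpha>] conjI) auto
qed

end

theorem theorem3p1:
  shows "\<exists>(P :: program) (T :: nat \<Rightarrow> nat).
    (\<lambda>n. real (T n)) \<in> O(\<lambda>n. real n ^ 2) \<and>
    (\<forall>(D :: 'a monoid) (F :: 'b ring) \<psi> (p :: nat) (m :: nat) (q :: nat) (n :: nat) (k :: nat).
       comm_group D \<and> finite (carrier D) \<and> order D = q \<and>
       prime p \<and> 1 \<le> m \<and> q = p ^ m \<and>
       field F \<and> finite (carrier F) \<and> order F = q \<and>
       \<psi> \<in> iso D (add_monoid F) \<and>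
       1 \<le> k \<and> k \<le> n \<and> n \<le> q \<longrightarrow>
       (\<exists>C. algebraic_code D n C \<and>
            has_dimension D C k \<and>
            minimum_distance D n C = n - k + 1 \<and>
            (\<exists>\<alpha>. (\<forall>i<n. \<alpha> i \<in> carrier F) \<and>
                  decodes_in_time P (T n) D F \<psi> n k \<alpha> C)))"
proof (intro exI[of _ decoder] exI[of _ decoding_time] conjI allI impI decoding_time_quadratic)
  fix D :: "'a monoid" and F :: "'b ring" and \<psi> and p m q n k :: nat
  assume asm: "comm_group D \<and> finite (carrier D) \<and> order D = q \<and>
       prime p \<and> 1 \<le> m \<and> q = p ^ m \<and>
       field F \<and> finite (carrier F) \<and> order F = q \<and>
       \<psi> \<in> iso D (add_monoid F) \<and> 1 \<le> k \<and> k \<le> n \<and> n \<le> q"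
  interpret alphabet F "UP F" D \<psi>
  proof (intro alphabet.intro alphabet_axioms.intro finite_field_polynomials.intro
      finite_field_polynomials_axioms.intro UP_domain.intro)
    show "field F" "finite (carrier F)" "\<psi> \<in> iso D (add_monoid F)"
      using asm by auto
    then show "domain F"
      by (simp add: field.axioms)
    show "group D"
      using asm by (auto intro: comm_group.axioms)
  qed
  show "\<exists>C. algebraic_code D n C \<and> has_dimension D C k \<and> minimum_distance D n C = n - k + 1 \<and>
    (\<exists>\<alpha>. (\<forall>i<n. \<alpha> i \<in> carrier F) \<and> decodes_in_time decoder (decoding_time n) D F \<psi> n k \<alpha> C)"
    using asm by (intro code_exists) auto
qed

end
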